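(* Let $K$ be a field, $n\geq 1$, $S=K[x_1,\ldots,x_n]$, and let $I\subset S$ be a monomial ideal with $g(I)\leq 3$. Then $I$ and $S/I$ satisfy Stanley's conjecture, that is: if $I\neq 0$ then $\operatorname{sdepth}(I)\geq\operatorname{depth}(I)$, and if $I\neq S$ then $\operatorname{sdepth}(S/I)\geq\operatorname{depth}(S/I)$.
   Context: For a monomial ideal $I\subset S$, $G(I)$ denotes its set of minimal monomial generators and $g(I)=|G(I)|$. The depth of a finitely generated graded $S$-module is taken with respect to the maximal ideal $(x_1,\ldots,x_n)$. $S$ is given the standard $\mathbb{Z}^n$-grading, with $\deg x_i$ the $i$-th unit vector. Let $M\neq 0$ be a finitely generated $\mathbb{Z}^n$-graded $S$-module. A Stanley decomposition of $M$ is a direct sum decomposition of $K$-vector spaces $\mathcal{D}: M=\bigoplus_{i=1}^r m_iK[Z_i]$ where each $m_i\in M$ is homogeneous, $Z_i\subset\{x_1,\ldots,x_n\}$, and $m_iK[Z_i]$ is a free $K[Z_i]$-module. Put $\operatorname{sdepth}(\mathcal{D})=\min_{1\le i\le r}|Z_i|$. The Stanley depth of $M$ is $\operatorname{sdepth}(M)=\max\{\operatorname{sdepth}(\mathcal{D}) : \mathcal{D}\text{ a Stanley decomposition of }M\}$. *)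

theory Defs
  imports
    "HOL-Library.Poly_Mapping"
    "HOL-Library.Extended_Nat"
    "HOL-Algebra.Module"
    "HOL-Algebra.QuotRing"
    "HOL-Algebra.Algebraic_Closure_Type"
begin

section \<open>Depth of a module\<close>

text \<open>The submodule \<open>(a\<^sub>1, \<dots>, a\<^sub>r) M\<close>; it is the zero submodule for the empty list.\<close>

definition list_smult :: "('a, 'r) ring_scheme \<Rightarrow> 'a list \<Rightarrow> ('a, 'm, 'e) module_scheme \<Rightarrow> 'm set"
  where "list_smult R as M =
    {\<Oplus>\<^bsub>M\<^esub>i\<in>{..<length as}. (as ! i) \<odot>\<^bsub>M\<^esub> v i | v. v \<in> {..<length as} \<rightarrow> carrier M}"

text \<open>The second conjunct says that \<open>a\<^sub>i\<close> is a nonzerodivisor on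
  \<open>M / (a\<^sub>1, \<dots>, a\<^sub>i\<^sub>-\<^sub>1) M\<close>, unfolded so as not to form the quotient.\<close>

definition regular_sequence :: "('a, 'r) ring_scheme \<Rightarrow> ('a, 'm, 'e) module_scheme \<Rightarrow> 'a list \<Rightarrow> bool"
  where "regular_sequence R M as \<longleftrightarrow>
    set as \<subseteq> carrier R \<and>
    (\<forall>i<length as. \<forall>v\<in>carrier M.
       (as ! i) \<odot>\<^bsub>M\<^esub> v \<in> list_smult R (take i as) M \<longrightarrow> v \<in> list_smult R (take i as) M) \<and>
    list_smult R as M \<noteq> carrier M"

definition depth :: "('a, 'r) ring_scheme \<Rightarrow> 'a set \<Rightarrow> ('a, 'm, 'e) module_scheme \<Rightarrow> enat"
  where "depth R J M = Sup {enat (length as) | as. set as \<subseteq> J \<and> regular_sequence R M as}"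

section \<open>Polynomial rings and monomial ideals\<close>

text \<open>A monomial is identified with its exponent vector of type \<open>'n \<Rightarrow>\<^sub>0 nat\<close>, so that
  \<open>K[x\<^sub>1, \<dots>, x\<^sub>n]\<close> with \<open>n = CARD('n) \<ge> 1\<close> is the following type.\<close>

type_synonym ('n, 'k) mpoly = "('n \<Rightarrow>\<^sub>0 nat) \<Rightarrow>\<^sub>0 'k"

abbreviation mpoly_ring :: "('n::finite, 'k::field) mpoly ring"
  where "mpoly_ring \<equiv> ring_of_type_algebra"

definition monomials :: "('n::finite, 'k::field) mpoly set"
  where "monomials = range (\<lambda>t. Poly_Mapping.single t 1)"

definition var :: "'n \<Rightarrow> ('n::finite, 'k::field) mpoly"
  where "var i = Poly_Mapping.single (Poly_Mapping.single i 1) 1"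

definition irrelevant_ideal :: "('n::finite, 'k::field) mpoly set"
  where "irrelevant_ideal = Idl\<^bsub>mpoly_ring\<^esub> (range var)"

definition monomial_ideal :: "('n::finite, 'k::field) mpoly set \<Rightarrow> bool"
  where "monomial_ideal I \<longleftrightarrow> (\<exists>T \<subseteq> monomials. I = Idl\<^bsub>mpoly_ring\<^esub> T)"

text \<open>The minimal monomial generators: the monomials of \<open>I\<close> that are minimal with respect to
  divisibility.  This set is finite for every \<open>I\<close> (Dickson's lemma).\<close>

definition min_gens :: "('n::finite, 'k::field) mpoly set \<Rightarrow> ('n, 'k) mpoly set"
  where "min_gens I = {u \<in> I \<inter> monomials. \<forall>v \<in> I \<inter> monomials. v dvd u \<longrightarrow> v = u}"

text \<open>The subalgebra \<open>K[Z]\<close> for a set of variables \<open>Z\<close>.\<close>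

definition polys_in :: "'n set \<Rightarrow> ('n::finite, 'k::field) mpoly set"
  where "polys_in Z = {f. \<forall>t \<in> Poly_Mapping.keys f. Poly_Mapping.keys t \<subseteq> Z}"

section \<open>Stanley depth\<close>

text \<open>A \<open>\<int>\<^sup>n\<close>-grading of \<open>M\<close> is given by its family of graded components
  \<open>gr :: ('n \<Rightarrow> int) \<Rightarrow> 'm set\<close>.\<close>

definition stanley_space ::
    "(('n::finite, 'k::field) mpoly, 'm, 'e) module_scheme \<Rightarrow> 'm \<times> 'n set \<Rightarrow> 'm set"
  where "stanley_space M = (\<lambda>(m, Z). (\<lambda>f. f \<odot>\<^bsub>M\<^esub> m) ` polys_in Z)"

text \<open>The injectivity condition says that \<open>m K[Z]\<close> is a free \<open>K[Z]\<close>-module with basis \<open>m\<close>;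
  the last condition says that \<open>M\<close> is the (internal) direct sum of the Stanley spaces.\<close>

definition stanley_decomposition ::
    "(('n::finite, 'k::field) mpoly, 'm, 'e) module_scheme \<Rightarrow> (('n \<Rightarrow> int) \<Rightarrow> 'm set)
      \<Rightarrow> ('m \<times> 'n set) list \<Rightarrow> bool"
  where "stanley_decomposition M gr D \<longleftrightarrow>
    (\<forall>(m, Z) \<in> set D. m \<in> carrier M \<and> (\<exists>a. m \<in> gr a) \<and>
       inj_on (\<lambda>f. f \<odot>\<^bsub>M\<^esub> m) (polys_in Z)) \<and>
    bij_betw (\<lambda>w. \<Oplus>\<^bsub>M\<^esub>i\<in>{..<length D}. w i)
      (\<Pi>\<^sub>E i\<in>{..<length D}. stanley_space M (D ! i)) (carrier M)"

definition sdepth_decomposition :: "('m \<times> 'n set) list \<Rightarrow> nat"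
  where "sdepth_decomposition D = Min ((\<lambda>(m, Z). card Z) ` set D)"

text \<open>The set below is bounded by \<open>CARD('n)\<close> for \<open>M \<noteq> 0\<close>, hence the maximum exists as soon
  as there is a Stanley decomposition; the definition is meaningful only for finitely generated
  graded \<open>M \<noteq> 0\<close>.\<close>

definition sdepth ::
    "(('n::finite, 'k::field) mpoly, 'm, 'e) module_scheme \<Rightarrow> (('n \<Rightarrow> int) \<Rightarrow> 'm set) \<Rightarrow> nat"
  where "sdepth M gr = Max {sdepth_decomposition D | D. stanley_decomposition M gr D}"

section \<open>The graded modules \<open>I\<close> and \<open>S/I\<close>\<close>

text \<open>The fields \<open>mult\<close> and \<open>one\<close> of a module record play no role.\<close>

definition ideal_module :: "('a, 'r) ring_scheme \<Rightarrow> 'a set \<Rightarrow> ('a, 'a) module"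
  where "ideal_module R I =
    \<lparr>carrier = I, monoid.mult = (\<otimes>\<^bsub>R\<^esub>), one = \<one>\<^bsub>R\<^esub>, zero = \<zero>\<^bsub>R\<^esub>,
     add = (\<oplus>\<^bsub>R\<^esub>), module.smult = (\<otimes>\<^bsub>R\<^esub>)\<rparr>"

definition quotient_module :: "('a, 'r) ring_scheme \<Rightarrow> 'a set \<Rightarrow> ('a, 'a set) module"
  where "quotient_module R I =
    \<lparr>carrier = carrier (R Quot I), monoid.mult = (\<otimes>\<^bsub>R Quot I\<^esub>), one = \<one>\<^bsub>R Quot I\<^esub>,
     zero = \<zero>\<^bsub>R Quot I\<^esub>, add = (\<oplus>\<^bsub>R Quot I\<^esub>),
     module.smult = (\<lambda>a Y. (I +>\<^bsub>R\<^esub> a) \<otimes>\<^bsub>R Quot I\<^esub> Y)\<rparr>"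

text \<open>The component of degree \<open>a\<close> is \<open>K x\<^sup>a\<close>, or \<open>0\<close> if \<open>a\<close> has a negative entry.\<close>

definition poly_grading :: "('n \<Rightarrow> int) \<Rightarrow> ('n::finite, 'k::field) mpoly set"
  where "poly_grading a =
    {f. \<forall>t \<in> Poly_Mapping.keys f. \<forall>i. int (Poly_Mapping.lookup t i) = a i}"

definition ideal_grading ::
    "('n::finite, 'k::field) mpoly set \<Rightarrow> ('n \<Rightarrow> int) \<Rightarrow> ('n, 'k) mpoly set"
  where "ideal_grading I a = I \<inter> poly_grading a"

definition quotient_grading ::
    "('n::finite, 'k::field) mpoly set \<Rightarrow> ('n \<Rightarrow> int) \<Rightarrow> ('n, 'k) mpoly set set"
  where "quotient_grading I a = (\<lambda>f. I +>\<^bsub>mpoly_ring\<^esub> f) ` poly_grading a"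

end

theory Submission
  imports Defs "HOL-Library.Cardinality"
begin

text \<open>
  The depths are bounded from above by nonvanishing Koszul homology: if \<open>H\<^sub>j(x; M) \<noteq> 0\<close>, then every
  regular sequence on \<open>M\<close> in \<open>(x\<^sub>1, \<dots>, x\<^sub>n)\<close> has length at most \<open>n - j\<close>, because a class in degree
  \<open>j\<close> modulo \<open>(a\<^sub>1, \<dots>, a\<^sub>k)\<close> is turned into one in degree \<open>j + 1\<close> modulo \<open>(a\<^sub>1, \<dots>, a\<^sub>k\<^sub>+\<^sub>1)\<close> by the
  wedge product with a vector \<open>b\<close> such that \<open>a\<^sub>k\<^sub>+\<^sub>1 = \<Sum>\<^sub>i x\<^sub>i b\<^sub>i\<close>.  Explicit monomial classes
  give \<open>depth (S/I) \<le> n - min g(I) 2\<close> and \<open>depth I \<le> n - 1\<close> for \<open>g(I) \<ge> 2\<close>, and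
  \<open>depth (S/I) \<le> n - 3\<close> if \<open>g(I) = 3\<close> and no generator divides the least common multiple of the
  other two.

  The Stanley depths are bounded from below by partitions of the monomials into cones.  Removing the
  multiples of a monomial from a cone costs one dimension, so \<open>sdepth (S/I) \<ge> n - g(I)\<close>; for
  \<open>I = (u, v, w)\<close> the partition of \<open>I\<close> into \<open>(u) - (v)\<close>, \<open>(v) - (w)\<close>, \<open>(w) - (u)\<close> and
  \<open>(u) \<inter> (v) \<inter> (w)\<close> gives \<open>sdepth I \<ge> n - 1\<close>.
\<close>

section \<open>Koszul complexes\<close>

text \<open>Only one-sided bounds have to meet, so no exact depth and no resolution is computed.
  Removing generators one by one from the complement loses one dimension each, which suffices
  whenever a Koszul class of degree \<open>g(I)\<close> is available. The obstacle is three
  generators one of which divides the least common multiple of the other two: the depth bound then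
  stays at \<open>n - 2\<close>, and the partition has to save a dimension. That a class is nonzero
  is certified by a scalar cochain read in a single multidegree \<open>L\<close>, where the Koszul
  differential transposes to the simplicial coboundary. The cochains are wedge products of one-forms
  with values 0 and 1, so the argument does not depend on the characteristic. Homology of quotient
  modules is never formed: chains have polynomial coefficients, and cycles and boundaries are taken
  modulo an ideal that grows along the regular sequence.\<close>

definition idx :: "'n::finite \<Rightarrow> nat"
  where "idx = (SOME f. inj f)"

lemma inj_idx: "inj (idx :: 'n::finite \<Rightarrow> nat)"
proof -
  have "\<exists>f :: 'n \<Rightarrow> nat. inj f"
    using finite_imp_inj_to_nat_seg[of "UNIV :: 'n set"] by auto
  then show ?thesis unfolding idx_def by (rule someI_ex)
qed

text \<open>The sign of moving the basis vector of \<open>i\<close> past the smaller elements of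
  \<open>T\<close>. The index type is only finite, so the order of the variables comes from an
  arbitrary injection \<open>idx\<close>. The strict inequality lets one formula serve for
  \<open>i \<in> T\<close> and \<open>i \<notin> T\<close>.\<close>

definition ksign :: "'n::finite \<Rightarrow> 'n set \<Rightarrow> 'a::comm_ring_1"
  where "ksign i T = (-1) ^ card {k\<in>T. idx k < idx i}"

definition wedge :: "('n::finite \<Rightarrow> 'a::comm_ring_1) \<Rightarrow> ('n set \<Rightarrow> 'a) \<Rightarrow> 'n set \<Rightarrow> 'a"
  where "wedge c z T = (\<Sum>i\<in>T. ksign i T * c i * z (T - {i}))"

text \<open>With \<open>x = var\<close> this is the Koszul differential. As for
  \<open>wedge\<close>, an element of the exterior algebra is its family of coefficients over all
  subsets, all degrees at once.\<close>

definition contract :: "('n::finite \<Rightarrow> 'a::comm_ring_1) \<Rightarrow> ('n set \<Rightarrow> 'a) \<Rightarrow> 'n set \<Rightarrow> 'a"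
  where "contract x z T = (\<Sum>i\<in>-T. ksign i T * x i * z (insert i T))"

lemma ksign_square [simp]: "ksign i T * ksign i T = (1 :: 'a::comm_ring_1)"
  by (simp add: ksign_def power_mult_distrib[symmetric])

lemma ksign_cases: "ksign i T = (1 :: 'a::comm_ring_1) \<or> ksign i T = (-1 :: 'a)"
  by (simp add: ksign_def minus_one_power_iff)

lemma ksign_remove: "idx i \<le> idx j \<Longrightarrow> ksign i (T - {j}) = ksign i T"
  unfolding ksign_def by (intro arg_cong[where f = "\<lambda>A. (-1) ^ card A"]) auto

lemma ksign_insert: "idx i \<le> idx j \<Longrightarrow> ksign i (insert j T) = ksign i T"
  unfolding ksign_def by (intro arg_cong[where f = "\<lambda>A. (-1) ^ card A"]) auto

lemma ksign_remove_less:
  assumes "j \<in> T" "idx j < idx i"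
  shows "ksign i (T - {j}) = - ksign i T"
proof -
  have "{k\<in>T. idx k < idx i} = insert j {k\<in>T - {j}. idx k < idx i}"
    using assms by auto
  then have "card {k\<in>T. idx k < idx i} = Suc (card {k\<in>T - {j}. idx k < idx i})"
    by simp
  then show ?thesis by (simp add: ksign_def)
qed

text \<open>Exactly one of the two indices is smaller, and removing it flips the sign of the other:
  distinct basis vectors anticommute.\<close>

lemma ksign_swap:
  fixes T :: "'n::finite set"
  assumes "i \<in> T" "j \<in> T" "i \<noteq> j"
  shows "ksign j T * ksign i (T - {j}) = - (ksign i T * ksign j (T - {i}) :: 'a::comm_ring_1)"
proof -
  have "idx i \<noteq> idx j" using assms(3) inj_idx by (auto dest: injD)
  then consider "idx i < idx j" | "idx j < idx i" by linarith
  then show ?thesis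
    using assms by cases (simp_all add: ksign_remove ksign_remove_less)
qed

section \<open>Exterior multiplication by one-forms\<close>

lemma wedge_add_left: "wedge (\<lambda>i. c i + d i) z T = wedge c z T + wedge d z T"
  by (simp add: wedge_def algebra_simps sum.distrib)

lemma wedge_zero_left: "(\<And>i. i \<in> T \<Longrightarrow> c i = 0) \<Longrightarrow> wedge c z T = 0"
  by (simp add: wedge_def)

lemma wedge_zero_right: "(\<And>U. U \<subseteq> T \<Longrightarrow> z U = 0) \<Longrightarrow> wedge c z T = 0"
  unfolding wedge_def by (intro sum.neutral) auto

lemma wedge_supported:
  assumes "\<And>U. z U \<noteq> 0 \<Longrightarrow> card U = j" "wedge c z T \<noteq> 0"
  shows "card T = Suc j"
proof -
  obtain i where "i \<in> T" "z (T - {i}) \<noteq> 0"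
    using assms(2) unfolding wedge_def by (rule sum.not_neutral_contains_not_neutral) (metis mult_zero_right)
  then have "card (T - {i}) = j" using assms(1) by blast
  then show ?thesis using card_Suc_Diff1[OF finite \<open>i \<in> T\<close>] by simp
qed

lemma wedge_single_term:
  assumes "i \<in> T" "\<And>j. j \<in> T \<Longrightarrow> j \<noteq> i \<Longrightarrow> c j = 0"
  shows "wedge c z T = ksign i T * c i * z (T - {i})"
proof -
  have "wedge c z T = (\<Sum>j\<in>{i}. ksign j T * c j * z (T - {j}))"
    unfolding wedge_def by (intro sum.mono_neutral_right) (use assms in auto)
  then show ?thesis by simp
qed

text \<open>Summing over all pairs with a zero diagonal keeps the index set symmetric, so that the
  two summations can be exchanged.\<close>

lemma wedge_wedge:
  "wedge c (wedge d z) T = (\<Sum>i\<in>T. \<Sum>j\<in>T. if i = j then 0 else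
     ksign i T * ksign j (T - {i}) * c i * d j * z (T - {i,j}))"
proof -
  have "wedge c (wedge d z) T = (\<Sum>i\<in>T. \<Sum>j\<in>T - {i}. 
     ksign i T * ksign j (T - {i}) * c i * d j * z (T - {i,j}))"
    unfolding wedge_def
    by (intro sum.cong refl) (auto simp: sum_distrib_left algebra_simps Diff_insert2[symmetric] insert_commute intro!: sum.cong)
  also have "\<dots> = (\<Sum>i\<in>T. \<Sum>j\<in>T. if i = j then 0 else
     ksign i T * ksign j (T - {i}) * c i * d j * z (T - {i,j}))"
    by (intro sum.cong refl sum.mono_neutral_cong_left) auto
  finally show ?thesis .
qed

lemma wedge_anticommute:
  fixes c :: "'n::finite \<Rightarrow> 'a::comm_ring_1"
  shows "wedge c (wedge d z) T = - wedge d (wedge c z) T"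
proof -
  have "wedge d (wedge c z) T = (\<Sum>i\<in>T. \<Sum>j\<in>T. if j = i then 0 else
     ksign j T * ksign i (T - {j}) * d j * c i * z (T - {j,i}))"
    unfolding wedge_wedge by (rule sum.swap)
  also have "\<dots> = (\<Sum>i\<in>T. \<Sum>j\<in>T. - (if i = j then 0 else
     ksign i T * ksign j (T - {i}) * c i * d j * z (T - {i,j})))"
  proof (intro sum.cong refl)
    fix i j assume ij: "i \<in> T" "j \<in> T"
    have "{j, i} = {i, j}" by auto
    then show "(if j = i then 0 else ksign j T * ksign i (T - {j}) * d j * c i * z (T - {j,i}))
      = - (if i = j then 0 else ksign i T * ksign j (T - {i}) * c i * d j * z (T - {i,j}))"
      using ksign_swap[OF ij, where 'a='a] by (cases "i = j") simp_all
  qed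
  finally show ?thesis by (simp add: wedge_wedge sum_negf)
qed

text \<open>Not a consequence of anticommutativity in characteristic 2.\<close>

lemma wedge_self:
  fixes c :: "'n::finite \<Rightarrow> 'a::comm_ring_1"
  shows "wedge c (wedge c z) T = 0"
proof -
  define F where "F i j = ksign i T * ksign j (T - {i}) * c i * c j * z (T - {i,j})" for i j
  have F: "F j i = - F i j" if "i \<in> T" "j \<in> T" "i \<noteq> j" for i j
  proof -
    have "{j, i} = {i, j}" by auto
    then show ?thesis using ksign_swap[OF that, where 'a='a] by (simp add: F_def)
  qed
  have "wedge c (wedge c z) T = (\<Sum>i\<in>T. \<Sum>j\<in>T. if i = j then 0 else F i j)"
    unfolding wedge_wedge F_def ..
  \<comment> \<open>The off-diagonal pairs are split into two triangles, which cancel after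
    exchanging the indices without a division by 2.\<close>
  also have "\<dots> = (\<Sum>i\<in>T. \<Sum>j\<in>T. (if idx i < idx j then F i j else 0) + (if idx j < idx i then F i j else 0))"
    using inj_idx by (intro sum.cong refl) (auto dest: injD)
  also have "\<dots> = (\<Sum>i\<in>T. \<Sum>j\<in>T. if idx i < idx j then F i j else 0)
      + (\<Sum>i\<in>T. \<Sum>j\<in>T. if idx j < idx i then F i j else 0)"
    by (simp add: sum.distrib)
  also have "(\<Sum>i\<in>T. \<Sum>j\<in>T. if idx j < idx i then F i j else 0)
      = (\<Sum>i\<in>T. \<Sum>j\<in>T. if idx i < idx j then F j i else 0)"
    by (rule sum.swap)
  also have "\<dots> = (\<Sum>i\<in>T. \<Sum>j\<in>T. - (if idx i < idx j then F i j else 0))"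
    by (intro sum.cong refl) (auto intro: F)
  finally show ?thesis by (simp add: sum_negf)
qed

text \<open>Cartan's formula: the mixed terms \<open>G i l\<close> occur in the two composites with
  opposite signs, while the diagonal terms come from the \<open>i\<close> outside \<open>T\<close>
  in one composite and from those inside \<open>T\<close> in the other. Hence multiplication by the
  sum of the \<open>x i * b i\<close> is null-homotopic on the Koszul complex.\<close>

lemma contract_wedge_homotopy:
  fixes x :: "'n::finite \<Rightarrow> 'a::comm_ring_1"
  shows "contract x (wedge b z) T + wedge b (contract x z) T = (\<Sum>i\<in>UNIV. x i * b i) * z T"
proof -
  define G where "G i l = ksign i T * ksign l (insert i T) * x i * b l * z (insert i T - {l})" for i l
  have 1: "contract x (wedge b z) T = (\<Sum>i\<in>-T. x i * b i * z T + (\<Sum>l\<in>T. G i l))"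
    unfolding contract_def
  proof (intro sum.cong refl)
    fix i assume i: "i \<in> - T"
    have "wedge b z (insert i T) = ksign i T * b i * z T
        + (\<Sum>l\<in>T. ksign l (insert i T) * b l * z (insert i T - {l}))"
      using i by (simp add: wedge_def ksign_insert)
    then have "ksign i T * x i * wedge b z (insert i T) = (ksign i T * ksign i T) * x i * b i * z T
        + (\<Sum>l\<in>T. G i l)"
      by (simp add: algebra_simps sum_distrib_left G_def del: ksign_square)
    then show "ksign i T * x i * wedge b z (insert i T) = x i * b i * z T + (\<Sum>l\<in>T. G i l)"
      by simp
  qed
  have 2: "wedge b (contract x z) T = (\<Sum>l\<in>T. x l * b l * z T + (\<Sum>i\<in>-T. - G i l))"
    unfolding wedge_def
  proof (intro sum.cong refl)
    fix l assume l: "l \<in> T"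
    have *: "- (T - {l}) = insert l (- T)" using l by auto
    have sg: "ksign l T * ksign i (T - {l}) = - (ksign i T * ksign l (insert i T) :: 'a)" if "i \<in> - T" for i
    proof (cases "idx i < idx l")
      case True
      then have "ksign l T = - (ksign l (insert i T) :: 'a)"
        using ksign_remove_less[of i "insert i T" l] that by simp
      with True show ?thesis by (simp add: ksign_remove)
    next
      case False
      then have "idx l < idx i" using inj_idx l that by (metis ComplD injD linorder_neqE_nat)
      then show ?thesis using l by (simp add: ksign_remove_less ksign_insert)
    qed
    have "contract x z (T - {l}) = ksign l T * x l * z T
        + (\<Sum>i\<in>-T. ksign i (T - {l}) * x i * z (insert i (T - {l})))"
      unfolding contract_def * using l by (simp add: ksign_remove insert_absorb)
    then have "ksign l T * b l * contract x z (T - {l}) = (ksign l T * ksign l T) * x l * b l * z T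
        + (\<Sum>i\<in>-T. (ksign l T * ksign i (T - {l})) * x i * b l * z (insert i (T - {l})))"
      by (simp add: algebra_simps sum_distrib_left del: ksign_square)
    also have "(\<Sum>i\<in>-T. (ksign l T * ksign i (T - {l})) * x i * b l * z (insert i (T - {l})))
        = (\<Sum>i\<in>-T. - G i l)"
      by (intro sum.cong refl) (use l in \<open>auto simp: sg G_def insert_Diff_if\<close>)
    finally show "ksign l T * b l * contract x z (T - {l}) = x l * b l * z T + (\<Sum>i\<in>-T. - G i l)"
      by simp
  qed
  have "wedge b (contract x z) T = (\<Sum>l\<in>T. x l * b l * z T) - (\<Sum>l\<in>T. \<Sum>i\<in>-T. G i l)"
    by (simp only: 2 sum.distrib sum_negf diff_conv_add_uminus)
  also have "(\<Sum>l\<in>T. \<Sum>i\<in>-T. G i l) = (\<Sum>i\<in>-T. \<Sum>l\<in>T. G i l)"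
    by (rule sum.swap)
  finally have 3: "wedge b (contract x z) T = (\<Sum>l\<in>T. x l * b l * z T) - (\<Sum>i\<in>-T. \<Sum>l\<in>T. G i l)" .
  have "contract x (wedge b z) T + wedge b (contract x z) T
      = (\<Sum>i\<in>-T. x i * b i * z T) + (\<Sum>i\<in>T. x i * b i * z T)"
    unfolding 1 sum.distrib 3 by simp
  also have "\<dots> = (\<Sum>i\<in>- T \<union> T. x i * b i * z T)"
    by (intro sum.union_disjoint[symmetric]) auto
  also have "- T \<union> T = UNIV" by auto
  finally show ?thesis by (simp only: sum_distrib_right)
qed

text \<open>Inserting \<open>i\<close> into \<open>T\<close> and deleting it from \<open>U\<close>
  are inverse bijections of the index pairs. The transposition moves the differential from chains to
  cochains.\<close>

lemma wedge_contract_dual: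
  "(\<Sum>T\<in>UNIV. p T * contract x v T) = (\<Sum>U\<in>UNIV. wedge x p U * v U)"
proof -
  have "(\<Sum>T\<in>UNIV. p T * contract x v T)
      = (\<Sum>(T,i)\<in>(SIGMA T:UNIV. - T). p T * (ksign i T * x i * v (insert i T)))"
    by (simp add: contract_def sum_distrib_left sum.Sigma)
  also have "\<dots> = (\<Sum>(U,i)\<in>(SIGMA U:UNIV. U). ksign i U * x i * p (U - {i}) * v U)"
    by (rule sum.reindex_bij_witness[of _ "\<lambda>(U,i). (U - {i}, i)" "\<lambda>(T,i). (insert i T, i)"])
       (auto simp: ksign_insert)
  also have "\<dots> = (\<Sum>U\<in>UNIV. wedge x p U * v U)"
    by (simp add: wedge_def sum_distrib_right sum.Sigma)
  finally show ?thesis .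
qed

lemma contract_contract:
  fixes x :: "'n::finite \<Rightarrow> 'a::comm_ring_1"
  shows "contract x (contract x z) T = 0"
proof -
  \<comment> \<open>Pairing with the indicator of \<open>T\<close> reads off one coefficient, so the
    claim becomes the transpose of \<open>wedge_self\<close>.\<close>
  define p where "p U = (if U = T then 1 else 0 :: 'a)" for U
  have "contract x (contract x z) T = (\<Sum>U\<in>UNIV. p U * contract x (contract x z) U)"
  proof -
    have "p U * contract x (contract x z) U = (if U = T then contract x (contract x z) U else 0)" for U
      by (simp add: p_def)
    then show ?thesis by simp
  qed
  also have "\<dots> = (\<Sum>U\<in>UNIV. wedge x (wedge x p) U * z U)"
    unfolding wedge_contract_dual ..
  finally show ?thesis unfolding wedge_self by simp
qed

lemma contract_add: "contract x (\<lambda>T. y T + z T) T = contract x y T + contract x z T"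
  by (simp add: contract_def distrib_left sum.distrib)

lemma contract_scale: "contract x (\<lambda>T. a * z T) T = a * contract x z T"
  by (simp add: contract_def sum_distrib_left mult.left_commute mult.assoc)

section \<open>Partitions of sets of exponents into cones\<close>

definition upset :: "('n \<Rightarrow>\<^sub>0 nat) \<Rightarrow> ('n \<Rightarrow>\<^sub>0 nat) set"
  where "upset u = {t. \<forall>i. Poly_Mapping.lookup u i \<le> Poly_Mapping.lookup t i}"

definition cone :: "('n \<Rightarrow>\<^sub>0 nat) \<Rightarrow> 'n set \<Rightarrow> ('n \<Rightarrow>\<^sub>0 nat) set"
  where "cone t Z = {s \<in> upset t. \<forall>i. i \<notin> Z \<longrightarrow> Poly_Mapping.lookup s i = Poly_Mapping.lookup t i}"

text \<open>Finite disjoint unions of cones. A predicate on cones, rather than a bare dimension, can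
  also record a bounded coordinate, on which the case of three generators relies.\<close>

inductive coned :: "(('n \<Rightarrow>\<^sub>0 nat) \<Rightarrow> 'n set \<Rightarrow> bool) \<Rightarrow> ('n \<Rightarrow>\<^sub>0 nat) set \<Rightarrow> bool"
  for Q where
    empty: "coned Q {}"
  | add: "coned Q A \<Longrightarrow> Q t Z \<Longrightarrow> cone t Z \<inter> A = {} \<Longrightarrow> coned Q (cone t Z \<union> A)"

lemma upset_eq_cone: "upset u = cone u UNIV"
  by (simp add: cone_def)

lemma coned_cone: "Q t Z \<Longrightarrow> coned Q (cone t Z)"
  using coned.add[OF coned.empty, of Q t Z] by simp

lemma coned_Un: "coned Q A \<Longrightarrow> coned Q B \<Longrightarrow> A \<inter> B = {} \<Longrightarrow> coned Q (A \<union> B)"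
proof (induction rule: coned.induct)
  case (add A t Z)
  have "coned Q (cone t Z \<union> (A \<union> B))"
    by (rule coned.add) (use add in auto)
  then show ?case by (simp add: Un_assoc)
qed simp

lemma coned_diff:
  assumes "coned Q A" and "\<And>t Z. Q t Z \<Longrightarrow> coned Q' (cone t Z - B)"
  shows "coned Q' (A - B)"
  using assms(1)
proof (induction rule: coned.induct)
  case (add A t Z)
  have "coned Q' ((cone t Z - B) \<union> (A - B))"
    by (rule coned_Un) (use add assms(2) in auto)
  then show ?case by (simp add: Un_Diff)
qed (simp add: coned.empty)

lemma coned_mono:
  assumes "coned Q A" and "\<And>t Z. Q t Z \<Longrightarrow> Q' t Z"
  shows "coned Q' A"
  using coned_diff[OF assms(1), of Q' "{}"] assms(2) by (simp add: coned_cone)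

lemma cone_disjoint_upset:
  "i \<notin> Z \<Longrightarrow> Poly_Mapping.lookup t i < Poly_Mapping.lookup u i \<Longrightarrow> cone t Z \<inter> upset u = {}"
proof -
  assume "i \<notin> Z" and *: "Poly_Mapping.lookup t i < Poly_Mapping.lookup u i"
  then have "Poly_Mapping.lookup s i = Poly_Mapping.lookup t i" if "s \<in> cone t Z" for s
    using that by (simp add: cone_def)
  moreover have "Poly_Mapping.lookup u i \<le> Poly_Mapping.lookup s i" if "s \<in> upset u" for s
    using that by (simp add: upset_def)
  ultimately show ?thesis using * by fastforce
qed

lemma cone_diff_upset:
  fixes t u :: "'n::finite \<Rightarrow>\<^sub>0 nat"
  shows "coned (\<lambda>t' Z'. card Z - 1 \<le> card Z' \<and>
      (\<exists>i. i \<notin> Z' \<and> Poly_Mapping.lookup t' i < Poly_Mapping.lookup u i)) (cone t Z - upset u)"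
    (is "coned ?Q _")
proof (induction "\<Sum>i\<in>Z. Poly_Mapping.lookup u i - Poly_Mapping.lookup t i" arbitrary: t rule: less_induct)
  case less
  show ?case
  proof (cases "\<exists>i\<in>Z. Poly_Mapping.lookup t i < Poly_Mapping.lookup u i")
    case True
    then obtain i where i: "i \<in> Z" "Poly_Mapping.lookup t i < Poly_Mapping.lookup u i" by blast
    define t' where "t' = t + Poly_Mapping.single i 1"
    have t': "Poly_Mapping.lookup t' j = (if j = i then Suc (Poly_Mapping.lookup t i) else Poly_Mapping.lookup t j)" for j
      by (simp add: t'_def lookup_add lookup_single)
    have "(\<Sum>i\<in>Z. Poly_Mapping.lookup u i - Poly_Mapping.lookup t' i)
        < (\<Sum>i\<in>Z. Poly_Mapping.lookup u i - Poly_Mapping.lookup t i)"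
      by (rule sum_strict_mono_ex1) (use i in \<open>auto simp: t'\<close>)
    then have IH: "coned ?Q (cone t' Z - upset u)" by (rule less)
    have "s \<in> cone t Z \<longleftrightarrow> s \<in> cone t (Z - {i}) \<or> s \<in> cone t' Z" for s
    proof
      assume s: "s \<in> cone t Z"
      show "s \<in> cone t (Z - {i}) \<or> s \<in> cone t' Z"
      proof (cases "Poly_Mapping.lookup s i = Poly_Mapping.lookup t i")
        case True
        then have "s \<in> cone t (Z - {i})" using s by (auto simp: cone_def)
        then show ?thesis ..
      next
        case False
        moreover have "Poly_Mapping.lookup t i \<le> Poly_Mapping.lookup s i"
          using s by (simp add: cone_def upset_def)
        ultimately have "Suc (Poly_Mapping.lookup t i) \<le> Poly_Mapping.lookup s i" by simp
        then have "s \<in> cone t' Z" using s i(1) by (auto simp: cone_def upset_def t')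
        then show ?thesis ..
      qed
    next
      assume "s \<in> cone t (Z - {i}) \<or> s \<in> cone t' Z"
      then show "s \<in> cone t Z"
      proof
        assume "s \<in> cone t' Z"
        moreover have "Poly_Mapping.lookup t j \<le> Poly_Mapping.lookup t' j" for j by (simp add: t')
        ultimately show ?thesis using i(1) unfolding cone_def upset_def
          by (auto simp: t' intro: order_trans)
      qed (auto simp: cone_def)
    qed
    then have "cone t Z = cone t (Z - {i}) \<union> cone t' Z" by blast
    moreover have "cone t (Z - {i}) \<inter> upset u = {}"
      by (rule cone_disjoint_upset[of i]) (use i in auto)
    ultimately have "cone t Z - upset u = cone t (Z - {i}) \<union> (cone t' Z - upset u)" by blast
    moreover have "cone t (Z - {i}) \<inter> cone t' Z = {}"
    proof -
      have "Poly_Mapping.lookup s i = Poly_Mapping.lookup t i" if "s \<in> cone t (Z - {i})" for s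
        using that by (simp add: cone_def)
      moreover have "Poly_Mapping.lookup s i > Poly_Mapping.lookup t i" if "s \<in> cone t' Z" for s
      proof -
        have "Poly_Mapping.lookup t' i \<le> Poly_Mapping.lookup s i" using that by (simp add: cone_def upset_def)
        then show ?thesis by (simp add: t')
      qed
      ultimately show ?thesis by fastforce
    qed
    then have "coned ?Q (cone t (Z - {i}) \<union> (cone t' Z - upset u))"
      by (intro coned.add IH) (use i in auto)
    ultimately show ?thesis by (simp only:)
  next
    case False
    show ?thesis
    proof (cases "\<exists>i. i \<notin> Z \<and> Poly_Mapping.lookup t i < Poly_Mapping.lookup u i")
      case True
      then have "cone t Z \<inter> upset u = {}"
        by (elim exE conjE) (rule cone_disjoint_upset)
      then have "cone t Z - upset u = cone t Z" by blast
      moreover have "coned ?Q (cone t Z)" by (rule coned_cone) (use True in simp)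
      ultimately show ?thesis by (simp only:)
    next
      case False': False
      with False have "\<forall>i. Poly_Mapping.lookup u i \<le> Poly_Mapping.lookup t i" by (meson not_le)
      then have "cone t Z \<subseteq> upset u" by (auto simp: cone_def upset_def intro: order_trans)
      then have "cone t Z - upset u = {}" by blast
      then show ?thesis by (simp only: coned.empty)
    qed
  qed
qed

section \<open>Cone partitions of monomial ideals and of their complements\<close>

abbreviation coned_dim :: "nat \<Rightarrow> ('n \<Rightarrow>\<^sub>0 nat) set \<Rightarrow> bool"
  where "coned_dim k \<equiv> coned (\<lambda>t Z. k \<le> card Z)"

lemma coned_dim_diff_upset:
  fixes A :: "('n::finite \<Rightarrow>\<^sub>0 nat) set"
  assumes "coned_dim k A"
  shows "coned_dim (k - 1) (A - upset u)"
  using assms by (rule coned_diff) (rule coned_mono[OF cone_diff_upset], auto)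

lemma coned_dim_UNIV: "coned_dim (CARD('n)) (UNIV :: ('n::finite \<Rightarrow>\<^sub>0 nat) set)"
proof -
  have "UNIV = cone (0 :: 'n \<Rightarrow>\<^sub>0 nat) UNIV" by (auto simp: cone_def upset_def)
  moreover have "coned_dim (CARD('n)) (cone (0 :: 'n \<Rightarrow>\<^sub>0 nat) UNIV)" by (rule coned_cone) simp
  ultimately show ?thesis by simp
qed

lemma coned_dim_upset: "coned_dim (CARD('n)) (upset (u :: 'n::finite \<Rightarrow>\<^sub>0 nat))"
  unfolding upset_eq_cone by (rule coned_cone) simp

lemma coned_dim_Diff_upset_finite:
  fixes A :: "('n::finite \<Rightarrow>\<^sub>0 nat) set"
  assumes "finite G" "coned_dim k A"
  shows "coned_dim (k - card G) (A - \<Union> (upset ` G))"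
  using assms(1)
proof (induction G rule: finite_induct)
  case (insert u G)
  have "A - \<Union> (upset ` insert u G) = A - \<Union> (upset ` G) - upset u" by auto
  with coned_dim_diff_upset[OF insert.IH, of u] insert.hyps show ?case by (simp add: Diff_eq)
qed (simp add: assms(2))

text \<open>Every cone of the complement of \<open>upset w\<close> has a bounded coordinate below the one of \<open>w\<close>,
  hence it misses \<open>upset u\<close> or \<open>upset v\<close>, and only one more dimension is lost.\<close>

lemma coned_dim_compl_three:
  fixes u v w :: "'n::finite \<Rightarrow>\<^sub>0 nat"
  assumes "\<And>i. Poly_Mapping.lookup w i \<le> max (Poly_Mapping.lookup u i) (Poly_Mapping.lookup v i)"
  shows "coned_dim (CARD('n) - 2) (UNIV - \<Union> (upset ` {u, v, w}))"
proof -
  have "coned_dim (CARD('n) - 2) (cone 0 UNIV - upset w - (upset u \<union> upset v))"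
  proof (rule coned_diff[OF cone_diff_upset])
    fix t :: "'n \<Rightarrow>\<^sub>0 nat" and Z
    assume "CARD('n) - 1 \<le> card Z \<and>
      (\<exists>i. i \<notin> Z \<and> Poly_Mapping.lookup t i < Poly_Mapping.lookup w i)"
    then obtain i where Z: "CARD('n) - 1 \<le> card Z" and i: "i \<notin> Z" "Poly_Mapping.lookup t i < Poly_Mapping.lookup w i"
      by blast
    have "coned_dim (CARD('n) - 1) (cone t Z)" using Z by (rule coned_cone)
    then have *: "coned_dim (CARD('n) - 2) (cone t Z - upset x)" for x
      using coned_dim_diff_upset[of "CARD('n) - 1" "cone t Z" x] by (simp add: numeral_2_eq_2)
    have "Poly_Mapping.lookup t i < Poly_Mapping.lookup u i \<or> Poly_Mapping.lookup t i < Poly_Mapping.lookup v i"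
      using assms[of i] i(2) by auto
    then consider "cone t Z \<inter> upset u = {}" | "cone t Z \<inter> upset v = {}"
      using cone_disjoint_upset[OF i(1)] by blast
    then have "cone t Z - (upset u \<union> upset v) = cone t Z - upset v \<or> cone t Z - (upset u \<union> upset v) = cone t Z - upset u"
      by cases blast+
    with * show "coned_dim (CARD('n) - 2) (cone t Z - (upset u \<union> upset v))" by metis
  qed
  moreover have "cone 0 UNIV - upset w - (upset u \<union> upset v) = UNIV - \<Union> (upset ` {u, v, w})"
    by (auto simp: cone_def) (auto simp: upset_def)
  ultimately show ?thesis by simp
qed

lemma coned_dim_upset_Diff_upset: "coned_dim (CARD('n) - 1) (upset (u :: 'n::finite \<Rightarrow>\<^sub>0 nat) - upset v)"
  by (rule coned_dim_diff_upset[OF coned_dim_upset])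

lemma coned_dim_upset_2: "coned_dim (CARD('n) - 1) (upset (u :: 'n::finite \<Rightarrow>\<^sub>0 nat) \<union> upset v)"
proof -
  have "coned_dim (CARD('n) - 1) ((upset u - upset v) \<union> upset v)"
    by (intro coned_Un coned_dim_upset_Diff_upset coned_mono[OF coned_dim_upset]) auto
  then show ?thesis by (simp add: Un_Diff)
qed

definition exp_lcm :: "('n::finite \<Rightarrow>\<^sub>0 nat) \<Rightarrow> ('n \<Rightarrow>\<^sub>0 nat) \<Rightarrow> 'n \<Rightarrow>\<^sub>0 nat"
  where "exp_lcm u v = Abs_poly_mapping (\<lambda>i. max (Poly_Mapping.lookup u i) (Poly_Mapping.lookup v i))"

lemma lookup_exp_lcm [simp]:
  "Poly_Mapping.lookup (exp_lcm u v) i = max (Poly_Mapping.lookup u i) (Poly_Mapping.lookup v i)"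
  by (simp add: exp_lcm_def)

lemma upset_exp_lcm: "upset (exp_lcm u v) = upset u \<inter> upset v"
  by (auto simp: upset_def)

text \<open>Around the cycle \<open>u\<close>, \<open>v\<close>, \<open>w\<close>, an exponent in
  some but not all of the upsets passes from membership to nonmembership exactly once, so it lies in
  exactly one cyclic difference. Each difference removes a single upset and costs one dimension.
  Around a cycle of four, membership may alternate and the differences overlap.\<close>

lemma coned_dim_upset_3:
  "coned_dim (CARD('n) - 1) (upset (u :: 'n::finite \<Rightarrow>\<^sub>0 nat) \<union> upset v \<union> upset w)"
proof -
  have "coned_dim (CARD('n) - 1)
      ((upset u - upset v) \<union> ((upset v - upset w) \<union> ((upset w - upset u) \<union> upset (exp_lcm u (exp_lcm v w)))))"
    by (intro coned_Un coned_dim_upset_Diff_upset coned_mono[OF coned_dim_upset]) (auto simp: upset_exp_lcm)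
  also have "(upset u - upset v) \<union> ((upset v - upset w) \<union> ((upset w - upset u) \<union> upset (exp_lcm u (exp_lcm v w))))
      = upset u \<union> upset v \<union> upset w"
    by (auto simp: upset_exp_lcm)
  finally show ?thesis .
qed

lemma coned_list:
  assumes "coned Q A"
  obtains D where "\<And>i. i < length D \<Longrightarrow> Q (fst (D ! i)) (snd (D ! i))"
    "\<And>i j. i < length D \<Longrightarrow> j < length D \<Longrightarrow> i \<noteq> j \<Longrightarrow>
      cone (fst (D ! i)) (snd (D ! i)) \<inter> cone (fst (D ! j)) (snd (D ! j)) = {}"
    "A = (\<Union>i<length D. cone (fst (D ! i)) (snd (D ! i)))"
  using assms
proof (induction arbitrary: thesis rule: coned.induct)
  case empty
  show ?case by (rule empty[of "[]"]) auto
next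
  case (add A t Z)
  show ?case
  proof (rule add.IH)
    fix D
    assume D: "\<And>i. i < length D \<Longrightarrow> Q (fst (D ! i)) (snd (D ! i))"
    "\<And>i j. i < length D \<Longrightarrow> j < length D \<Longrightarrow> i \<noteq> j \<Longrightarrow>
      cone (fst (D ! i)) (snd (D ! i)) \<inter> cone (fst (D ! j)) (snd (D ! j)) = {}"
    "A = (\<Union>i<length D. cone (fst (D ! i)) (snd (D ! i)))"
    show thesis
    proof (rule add.prems[of "(t, Z) # D"])
      fix i assume "i < length ((t, Z) # D)"
      then show "Q (fst (((t, Z) # D) ! i)) (snd (((t, Z) # D) ! i))"
        using D(1) add.hyps by (cases i) auto
    next
      fix i j assume *: "i < length ((t, Z) # D)" "j < length ((t, Z) # D)" "i \<noteq> j"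
      show "cone (fst (((t, Z) # D) ! i)) (snd (((t, Z) # D) ! i)) \<inter>
         cone (fst (((t, Z) # D) ! j)) (snd (((t, Z) # D) ! j)) = {}"
      proof (cases i; cases j)
        fix i' j' assume "i = Suc i'" "j = Suc j'"
        then show ?thesis using D(2)[of i' j'] * by simp
      next
        fix j' assume "i = 0" "j = Suc j'"
        then show ?thesis using add.hyps(3) * unfolding D(3) by auto
      next
        fix i' assume "i = Suc i'" "j = 0"
        then show ?thesis using add.hyps(3) * unfolding D(3) by auto
      qed (use * in auto)
    next
      show "cone t Z \<union> A = (\<Union>i<length ((t, Z) # D). cone (fst (((t, Z) # D) ! i)) (snd (((t, Z) # D) ! i)))"
        by (simp add: lessThan_Suc_eq_insert_0 image_image D(3))
    qed
  qed
qed

section \<open>Ideals spanned by monomials\<close>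

text \<open>Ideals in terms of the type class operations; closure under negation is multiplication
  by -1. The bridge to the record-based ring is formed by \<open>ideal_mpoly_ring\<close> and
  \<open>ideal_like_ideal\<close>.\<close>

definition ideal_like :: "'a::comm_ring_1 set \<Rightarrow> bool"
  where "ideal_like J \<longleftrightarrow> 0 \<in> J \<and> (\<forall>f\<in>J. \<forall>g\<in>J. f + g \<in> J) \<and> (\<forall>f. \<forall>g\<in>J. f * g \<in> J)"

lemma ideal_like_zero: "ideal_like J \<Longrightarrow> 0 \<in> J"
  and ideal_like_add: "ideal_like J \<Longrightarrow> f \<in> J \<Longrightarrow> g \<in> J \<Longrightarrow> f + g \<in> J"
  and ideal_like_mult: "ideal_like J \<Longrightarrow> g \<in> J \<Longrightarrow> f * g \<in> J"
  by (auto simp: ideal_like_def)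

lemma ideal_like_mult_right: "ideal_like J \<Longrightarrow> f \<in> J \<Longrightarrow> f * g \<in> J"
  using ideal_like_mult[of J f g] by (simp add: mult.commute)

lemma ideal_like_uminus: "ideal_like J \<Longrightarrow> f \<in> J \<Longrightarrow> - f \<in> J"
  using ideal_like_mult[of J f "-1"] by simp

lemma ideal_like_diff: "ideal_like J \<Longrightarrow> f \<in> J \<Longrightarrow> g \<in> J \<Longrightarrow> f - g \<in> J"
  using ideal_like_add[of J f "- g"] ideal_like_uminus[of J g] by simp

lemma ideal_like_sum: "ideal_like J \<Longrightarrow> (\<And>i. i \<in> A \<Longrightarrow> f i \<in> J) \<Longrightarrow> sum f A \<in> J"
  by (induction A rule: infinite_finite_induct) (auto intro: ideal_like_zero ideal_like_add)

lemma ideal_like_wedge: "ideal_like J \<Longrightarrow> (\<And>T. z T \<in> J) \<Longrightarrow> wedge c z T \<in> J"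
  unfolding wedge_def by (intro ideal_like_sum ideal_like_mult)

lemma ideal_like_contract: "ideal_like J \<Longrightarrow> (\<And>T. z T \<in> J) \<Longrightarrow> contract x z T \<in> J"
  unfolding contract_def by (intro ideal_like_sum ideal_like_mult)

lemma ideal_mpoly_ring:
  assumes "ideal_like J"
  shows "ideal J (mpoly_ring :: ('n::finite, 'k::field) mpoly ring)"
proof (rule idealI)
  show "ring (mpoly_ring :: ('n, 'k) mpoly ring)" by (rule ring_from_type_algebra)
  then interpret ring "mpoly_ring :: ('n, 'k) mpoly ring" .
  show "subgroup J (add_monoid (mpoly_ring :: ('n, 'k) mpoly ring))"
  proof (rule add.subgroupI)
    fix f assume f: "f \<in> J"
    have "\<ominus>\<^bsub>mpoly_ring\<^esub> f = - f"
      by (rule minus_equality) (simp_all add: ring_of_type_algebra_def)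
    with f show "\<ominus>\<^bsub>mpoly_ring\<^esub> f \<in> J"
      using ideal_like_uminus[OF assms] by simp
  qed (use assms in \<open>auto simp: ring_of_type_algebra_def ideal_like_def\<close>)
qed (use ideal_like_mult[OF assms] ideal_like_mult_right[OF assms] in \<open>auto simp: ring_of_type_algebra_def\<close>)

lemma ideal_like_ideal:
  assumes "ideal J (mpoly_ring :: ('n::finite, 'k::field) mpoly ring)"
  shows "ideal_like J"
proof -
  interpret ideal J "mpoly_ring :: ('n, 'k) mpoly ring" by (rule assms)
  show ?thesis
    using additive_subgroup.zero_closed[OF is_additive_subgroup]
      additive_subgroup.a_closed[OF is_additive_subgroup] I_l_closed
    by (auto simp: ideal_like_def ring_of_type_algebra_def)
qed

text \<open>The combinations of the variables form an ideal containing every variable. The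
  coefficients \<open>b\<close> become the one-form that is wedged with a cycle when the regular
  sequence is extended.\<close>

lemma irrelevant_ideal_cases:
  assumes "f \<in> (irrelevant_ideal :: ('n::finite, 'k::field) mpoly set)"
  obtains b where "f = (\<Sum>i\<in>UNIV. var i * b i)"
proof -
  define J where "J = {f :: ('n, 'k) mpoly. \<exists>b. f = (\<Sum>i\<in>UNIV. var i * b i)}"
  have J_I: "(\<Sum>i\<in>UNIV. var i * b i) \<in> J" for b by (auto simp: J_def)
  interpret ring "mpoly_ring :: ('n, 'k) mpoly ring" by (rule ring_from_type_algebra)
  have "ideal_like J"
    unfolding ideal_like_def
  proof (intro conjI ballI allI)
    show "0 \<in> J" by (auto simp: J_def intro!: exI[of _ "\<lambda>_. 0"])
    fix f assume "f \<in> J"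
    then obtain b where b: "f = (\<Sum>i\<in>UNIV. var i * b i)" by (auto simp: J_def)
    show "g * f \<in> J" for g
    proof -
      have "g * f = (\<Sum>i\<in>UNIV. var i * (g * b i))"
        by (simp only: b sum_distrib_left mult.left_commute)
      then show ?thesis by (auto simp: J_def)
    qed
    show "f + g \<in> J" if "g \<in> J" for g
    proof -
      from that obtain c where c: "g = (\<Sum>i\<in>UNIV. var i * c i)" by (auto simp: J_def)
      have "f + g = (\<Sum>i\<in>UNIV. var i * (b i + c i))"
        by (simp only: b c sum.distrib distrib_left)
      then show ?thesis by (auto simp: J_def)
    qed
  qed
  then have "ideal J (mpoly_ring :: ('n, 'k) mpoly ring)" by (rule ideal_mpoly_ring)
  moreover have "var i \<in> J" for i
  proof -
    have "(\<Sum>j\<in>UNIV. var j * (if j = i then 1 else 0)) = (\<Sum>j\<in>UNIV. if j = i then var j else (0 :: ('n, 'k) mpoly))"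
      by (intro sum.cong) auto
    also have "\<dots> = var i" by simp
    finally show ?thesis using J_I[of "\<lambda>j. if j = i then 1 else 0"] by (simp only:)
  qed
  ultimately have "irrelevant_ideal \<subseteq> J"
    unfolding irrelevant_ideal_def by (intro genideal_minimal) auto
  with assms that show thesis by (auto simp: J_def)
qed

definition supported :: "('n \<Rightarrow>\<^sub>0 nat) set \<Rightarrow> ('n::finite, 'k::field) mpoly set"
  where "supported E = {f. Poly_Mapping.keys f \<subseteq> E}"

definition upclosed :: "('n \<Rightarrow>\<^sub>0 nat) set \<Rightarrow> bool"
  where "upclosed E \<longleftrightarrow> (\<forall>t\<in>E. \<forall>s. t + s \<in> E)"

lemma supported_mono: "E \<subseteq> F \<Longrightarrow> supported E \<subseteq> supported F"
  by (auto simp: supported_def)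

lemma ideal_like_supported:
  assumes "upclosed E"
  shows "ideal_like (supported E)"
  unfolding ideal_like_def
proof (intro conjI ballI allI)
  show "f + g \<in> supported E" if "f \<in> supported E" "g \<in> supported E" for f g :: "('a, 'b) mpoly"
    using that keys_add[of f g] by (auto simp: supported_def)
  show "f * g \<in> supported E" if g: "g \<in> supported E" for f g :: "('a, 'b) mpoly"
  proof -
    have "t \<in> E" if t: "t \<in> Poly_Mapping.keys (f * g)" for t
    proof -
      obtain a b where "t = a + b" "b \<in> Poly_Mapping.keys g"
        using keys_mult[of f g] t by auto
      moreover have "b \<in> E" using g calculation(2) by (auto simp: supported_def)
      then have "b + a \<in> E" using assms by (simp add: upclosed_def)
      ultimately show ?thesis by (simp add: add.commute)
    qed
    then show ?thesis by (auto simp: supported_def)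
  qed
qed (simp add: supported_def)

lemma xpow_in_supported [simp]: "(Poly_Mapping.single t 1 :: ('n::finite, 'k::field) mpoly) \<in> supported E \<longleftrightarrow> t \<in> E"
  by (simp add: supported_def)

lemma poly_mapping_sum_single:
  fixes f :: "'a \<Rightarrow>\<^sub>0 'b::comm_monoid_add"
  shows "f = (\<Sum>t\<in>Poly_Mapping.keys f. Poly_Mapping.single t (Poly_Mapping.lookup f t))"
proof (rule poly_mapping_eqI)
  fix s
  have "Poly_Mapping.lookup (\<Sum>t\<in>Poly_Mapping.keys f. Poly_Mapping.single t (Poly_Mapping.lookup f t)) s
      = (\<Sum>t\<in>Poly_Mapping.keys f. if t = s then Poly_Mapping.lookup f t else 0)"
    by (simp add: lookup_sum lookup_single when_def)
  also have "\<dots> = Poly_Mapping.lookup f s" by (simp add: in_keys_iff)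
  finally show "Poly_Mapping.lookup f s = Poly_Mapping.lookup
      (\<Sum>t\<in>Poly_Mapping.keys f. Poly_Mapping.single t (Poly_Mapping.lookup f t)) s" ..
qed

lemma lookup_single_mult_add:
  fixes f :: "('n, 'k::field) mpoly"
  shows "Poly_Mapping.lookup (Poly_Mapping.single t c * f) (t + s) = c * Poly_Mapping.lookup f s"
proof -
  have "Poly_Mapping.single t c * f = (\<Sum>r\<in>Poly_Mapping.keys f. Poly_Mapping.single (t + r) (c * Poly_Mapping.lookup f r))"
    by (subst poly_mapping_sum_single[of f]) (simp add: sum_distrib_left mult_single)
  then have "Poly_Mapping.lookup (Poly_Mapping.single t c * f) (t + s)
      = (\<Sum>r\<in>Poly_Mapping.keys f. if r = s then c * Poly_Mapping.lookup f r else 0)"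
    by (simp add: lookup_sum lookup_single when_def)
  also have "\<dots> = c * Poly_Mapping.lookup f s" by (simp add: in_keys_iff)
  finally show ?thesis .
qed

lemma keys_single_mult:
  "Poly_Mapping.keys (Poly_Mapping.single t c * f) \<subseteq> (+) t ` Poly_Mapping.keys (f :: ('n, 'k::field) mpoly)"
  using keys_mult[of "Poly_Mapping.single t c" f] by (cases "c = 0") auto

section \<open>Subquotients of the polynomial ring\<close>

lemma mpoly_ring_simps [simp]:
  "carrier (mpoly_ring :: ('n::finite, 'k::field) mpoly ring) = UNIV"
  "\<zero>\<^bsub>(mpoly_ring :: ('n, 'k) mpoly ring)\<^esub> = 0"
  "\<one>\<^bsub>(mpoly_ring :: ('n, 'k) mpoly ring)\<^esub> = 1"
  "f \<oplus>\<^bsub>(mpoly_ring :: ('n, 'k) mpoly ring)\<^esub> g = f + g"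
  "f \<otimes>\<^bsub>(mpoly_ring :: ('n, 'k) mpoly ring)\<^esub> g = f * g"
  by (simp_all add: ring_of_type_algebra_def)

text \<open>A presentation of \<open>M\<close> as \<open>supported E / supported F\<close> by the projection \<open>p\<close>,
  which covers both \<open>I\<close> and \<open>S/I\<close>.\<close>

locale monomial_subquotient =
  fixes E F :: "('n::finite \<Rightarrow>\<^sub>0 nat) set"
    and M :: "(('n, 'k::field) mpoly, 'm, 'e) module_scheme"
    and p :: "('n, 'k) mpoly \<Rightarrow> 'm"
  assumes upclosed_E: "upclosed E" and upclosed_F: "upclosed F" and F_subset: "F \<subseteq> E"
    and abelian_monoid: "abelian_monoid M"
    and carrier_eq: "carrier M = p ` supported E"
    and p_zero: "p 0 = \<zero>\<^bsub>M\<^esub>"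
    and p_add: "f \<in> supported E \<Longrightarrow> g \<in> supported E \<Longrightarrow> p (f + g) = p f \<oplus>\<^bsub>M\<^esub> p g"
    and p_smult: "f \<in> supported E \<Longrightarrow> p (c * f) = c \<odot>\<^bsub>M\<^esub> p f"
    and p_eq_iff: "f \<in> supported E \<Longrightarrow> g \<in> supported E \<Longrightarrow> p f = p g \<longleftrightarrow> f - g \<in> supported F"
begin

lemma ideal_E: "ideal_like (supported E :: ('n, 'k) mpoly set)"
  and ideal_F: "ideal_like (supported F :: ('n, 'k) mpoly set)"
  by (rule ideal_like_supported[OF upclosed_E], rule ideal_like_supported[OF upclosed_F])

lemma finsum_p:
  assumes "finite A" "\<And>i. i \<in> A \<Longrightarrow> f i \<in> supported E"
  shows "(\<Oplus>\<^bsub>M\<^esub>i\<in>A. p (f i)) = p (sum f A)"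
proof -
  interpret abelian_monoid M by (rule abelian_monoid)
  show ?thesis
    using assms
  proof (induction A rule: finite_induct)
    case (insert x A)
    have "(\<Oplus>\<^bsub>M\<^esub>i\<in>insert x A. p (f i)) = p (f x) \<oplus>\<^bsub>M\<^esub> (\<Oplus>\<^bsub>M\<^esub>i\<in>A. p (f i))"
      by (rule finsum_insert) (use insert carrier_eq in auto)
    also have "\<dots> = p (f x) \<oplus>\<^bsub>M\<^esub> p (sum f A)"
      using insert by simp
    also have "\<dots> = p (f x + sum f A)"
      by (rule p_add[symmetric]) (simp_all add: insert.prems ideal_like_sum[OF ideal_E])
    finally show ?case using insert.hyps by simp
  qed (simp add: p_zero)
qed

lemma finsum_eq:
  assumes "finite A" "\<And>i. i \<in> A \<Longrightarrow> f i \<in> supported E" "\<And>i. i \<in> A \<Longrightarrow> g i = p (f i)"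
  shows "(\<Oplus>\<^bsub>M\<^esub>i\<in>A. g i) = p (sum f A)"
proof -
  interpret abelian_monoid M by (rule abelian_monoid)
  have "(\<Oplus>\<^bsub>M\<^esub>i\<in>A. g i) = (\<Oplus>\<^bsub>M\<^esub>i\<in>A. p (f i))"
    by (rule finsum_cong') (use assms carrier_eq in auto)
  then show ?thesis using finsum_p[OF assms(1,2)] by simp
qed

text \<open>The preimage in \<open>supported E\<close> of the submodule generated by the first
  \<open>k\<close> elements. It turns the conditions of a regular sequence into statements about
  ideals of polynomials.\<close>

definition seq_ideal :: "('n, 'k) mpoly list \<Rightarrow> nat \<Rightarrow> ('n, 'k) mpoly set"
  where "seq_ideal as k = {f \<in> supported E.
    \<exists>w. (\<forall>i. w i \<in> supported E) \<and> f - (\<Sum>i<k. as ! i * w i) \<in> supported F}"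

lemma seq_idealI:
  "f \<in> supported E \<Longrightarrow> (\<And>i. w i \<in> supported E) \<Longrightarrow>
    f - (\<Sum>i<k. as ! i * w i) \<in> supported F \<Longrightarrow> f \<in> seq_ideal as k"
  unfolding seq_ideal_def by blast

lemma seq_idealE:
  assumes "f \<in> seq_ideal as k"
  obtains w where "f \<in> supported E" "\<And>i. w i \<in> supported E"
    "f - (\<Sum>i<k. as ! i * w i) \<in> supported F"
proof -
  from assms have "f \<in> supported E"
    "\<exists>w. (\<forall>i. w i \<in> supported E) \<and> f - (\<Sum>i<k. as ! i * w i) \<in> supported F"
    by (simp_all add: seq_ideal_def)
  then show thesis using that by blast
qed

lemma p_in_list_smult_iff:
  assumes k: "k \<le> length as" and f: "f \<in> supported E"
  shows "p f \<in> list_smult mpoly_ring (take k as) M \<longleftrightarrow> f \<in> seq_ideal as k"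
proof
  assume "p f \<in> list_smult mpoly_ring (take k as) M"
  then obtain v where v: "v \<in> {..<k} \<rightarrow> carrier M"
    and eq: "p f = (\<Oplus>\<^bsub>M\<^esub>i\<in>{..<k}. (take k as ! i) \<odot>\<^bsub>M\<^esub> v i)"
    unfolding list_smult_def length_take min.absorb2[OF k] by blast
  have "\<exists>g\<in>supported E. v i = p g" if "i < k" for i
    using v that carrier_eq by auto
  then obtain g where g: "\<And>i. i < k \<Longrightarrow> g i \<in> supported E \<and> v i = p (g i)" by metis
  \<comment> \<open>Padding with 0 meets the requirement that \<open>w i\<close> lies in
    \<open>supported E\<close> for every natural \<open>i\<close>.\<close>
  define w where "w i = (if i < k then g i else 0)" for i
  have w: "w i \<in> supported E" for i using g ideal_like_zero[OF ideal_E] by (simp add: w_def)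
  have "p f = p (\<Sum>i<k. as ! i * w i)"
    unfolding eq
    by (rule finsum_eq) (use g w in \<open>auto simp: w_def ideal_like_mult[OF ideal_E] p_smult\<close>)
  then have "f - (\<Sum>i<k. as ! i * w i) \<in> supported F"
    using p_eq_iff f w by (simp add: ideal_like_sum ideal_E ideal_like_mult)
  with f w show "f \<in> seq_ideal as k" by (rule seq_idealI)
next
  assume "f \<in> seq_ideal as k"
  then obtain w where w: "\<And>i. w i \<in> supported E" and *: "f - (\<Sum>i<k. as ! i * w i) \<in> supported F"
    by (rule seq_idealE) blast
  have "p f = p (\<Sum>i<k. as ! i * w i)"
    using p_eq_iff f w * by (simp add: ideal_like_sum ideal_E ideal_like_mult)
  also have "\<dots> = (\<Oplus>\<^bsub>M\<^esub>i\<in>{..<k}. (take k as ! i) \<odot>\<^bsub>M\<^esub> p (w i))"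
    by (rule finsum_eq[symmetric]) (use w in \<open>auto simp: ideal_like_mult[OF ideal_E] p_smult\<close>)
  finally show "p f \<in> list_smult mpoly_ring (take k as) M"
    unfolding list_smult_def length_take min.absorb2[OF k] using w carrier_eq by auto
qed

lemma seq_ideal_0: "seq_ideal as 0 = supported F"
  using supported_mono[OF F_subset] ideal_like_zero[OF ideal_E] by (auto simp: seq_ideal_def)

lemma ideal_like_seq_ideal: "ideal_like (seq_ideal as k)"
  unfolding ideal_like_def
proof (intro conjI ballI allI)
  show "0 \<in> seq_ideal as k"
    by (rule seq_idealI[of _ "\<lambda>_. 0"]) (simp_all add: ideal_like_zero ideal_E ideal_F)
  fix f assume "f \<in> seq_ideal as k"
  then obtain v where f: "f \<in> supported E" and v: "\<And>i. v i \<in> supported E"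
    and fv: "f - (\<Sum>i<k. as ! i * v i) \<in> supported F"
    by (rule seq_idealE) blast
  show "f + g \<in> seq_ideal as k" if gk: "g \<in> seq_ideal as k" for g
  proof -
    obtain w where g: "g \<in> supported E" and w: "\<And>i. w i \<in> supported E"
      and gw: "g - (\<Sum>i<k. as ! i * w i) \<in> supported F"
      using gk by (rule seq_idealE) blast
    have "f + g - (\<Sum>i<k. as ! i * (v i + w i))
        = (f - (\<Sum>i<k. as ! i * v i)) + (g - (\<Sum>i<k. as ! i * w i))"
      by (simp add: distrib_left sum.distrib)
    then have "f + g - (\<Sum>i<k. as ! i * (v i + w i)) \<in> supported F"
      using ideal_like_add[OF ideal_F fv gw] by (simp only:)
    then show ?thesis
      by (intro seq_idealI[of _ "\<lambda>i. v i + w i"] ideal_like_add[OF ideal_E] f g v w)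
  qed
  show "c * f \<in> seq_ideal as k" for c
  proof -
    have "c * f - (\<Sum>i<k. as ! i * (c * v i)) = c * (f - (\<Sum>i<k. as ! i * v i))"
      by (simp add: right_diff_distrib sum_distrib_left mult.left_commute)
    then have "c * f - (\<Sum>i<k. as ! i * (c * v i)) \<in> supported F"
      using ideal_like_mult[OF ideal_F fv, of c] by (simp only:)
    then show ?thesis
      by (intro seq_idealI[of _ "\<lambda>i. c * v i"] ideal_like_mult[OF ideal_E] f v)
  qed
qed

lemma seq_ideal_Suc:
  "f \<in> seq_ideal as (Suc k) \<longleftrightarrow> (\<exists>g\<in>seq_ideal as k. \<exists>v\<in>supported E. f = g + as ! k * v)"
proof
  assume "f \<in> seq_ideal as (Suc k)"
  then obtain w where f: "f \<in> supported E" and w: "\<And>i. w i \<in> supported E"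
    and *: "f - (\<Sum>i<Suc k. as ! i * w i) \<in> supported F"
    by (rule seq_idealE) blast
  have "f - as ! k * w k \<in> supported E"
    using f w by (simp add: ideal_like_diff ideal_like_mult ideal_E)
  moreover have "f - as ! k * w k - (\<Sum>i<k. as ! i * w i) = f - (\<Sum>i<Suc k. as ! i * w i)"
    by simp
  ultimately have "f - as ! k * w k \<in> seq_ideal as k"
    using w * by (intro seq_idealI[of _ w]) (simp_all only:)
  moreover have "f = (f - as ! k * w k) + as ! k * w k" by simp
  ultimately show "\<exists>g\<in>seq_ideal as k. \<exists>v\<in>supported E. f = g + as ! k * v" using w by blast
next
  assume "\<exists>g\<in>seq_ideal as k. \<exists>v\<in>supported E. f = g + as ! k * v"
  then obtain g v where g: "g \<in> seq_ideal as k" and v: "v \<in> supported E" and f: "f = g + as ! k * v"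
    by blast
  from g obtain w where gE: "g \<in> supported E" and w: "\<And>i. w i \<in> supported E"
    and *: "g - (\<Sum>i<k. as ! i * w i) \<in> supported F"
    by (rule seq_idealE) blast
  have "f - (\<Sum>i<Suc k. as ! i * (w(k := v)) i) = g - (\<Sum>i<k. as ! i * w i)"
    by (simp add: f)
  then have "f - (\<Sum>i<Suc k. as ! i * (w(k := v)) i) \<in> supported F"
    using * by (simp only:)
  moreover have "(w(k := v)) i \<in> supported E" for i using v w by simp
  moreover have "f \<in> supported E" using f gE v by (simp add: ideal_like_add ideal_like_mult ideal_E)
  ultimately show "f \<in> seq_ideal as (Suc k)" by (intro seq_idealI[of _ "w(k := v)"])
qed

text \<open>A representative of a nonzero class in degree \<open>j\<close> of the Koszul homology of
  \<open>supported E\<close> modulo \<open>N\<close>. Its coefficients outside degree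
  \<open>j\<close> are zero exactly, not only modulo \<open>N\<close>; this is what finally yields a
  set of variables of known size.\<close>

definition koszul_class :: "('n, 'k) mpoly set \<Rightarrow> nat \<Rightarrow> ('n set \<Rightarrow> ('n, 'k) mpoly) \<Rightarrow> bool"
  where "koszul_class N j z \<longleftrightarrow>
    (\<forall>T. z T \<in> supported E) \<and> (\<forall>T. z T \<noteq> 0 \<longrightarrow> card T = j) \<and> (\<forall>T. contract var z T \<in> N) \<and>
    \<not> (\<exists>v. (\<forall>T. v T \<in> supported E) \<and> (\<forall>T. z T - contract var v T \<in> N))"

text \<open>If the cycle \<open>z\<close> modulo \<open>N\<close> represents a nonzero class and \<open>a = \<Sum>\<^sub>i x\<^sub>i b\<^sub>i\<close> is a nonzerodivisor
  modulo \<open>N\<close>, then \<open>b \<and> z\<close> represents a nonzero class modulo \<open>N + (a)\<close>, because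
  \<open>d (b \<and> z) + b \<and> d z = a z\<close>.\<close>

lemma koszul_class_step:
  assumes z: "koszul_class (seq_ideal as k) j z"
    and a: "as ! k \<in> irrelevant_ideal"
    and regular: "\<And>f. f \<in> supported E \<Longrightarrow> as ! k * f \<in> seq_ideal as k \<Longrightarrow> f \<in> seq_ideal as k"
  shows "\<exists>w. koszul_class (seq_ideal as (Suc k)) (Suc j) w"
proof -
  obtain b where b: "as ! k = (\<Sum>i\<in>UNIV. var i * b i)"
    using a by (rule irrelevant_ideal_cases)
  note N = ideal_like_seq_ideal[of as k]
  from z have zE: "\<And>T. z T \<in> supported E" and zj: "\<And>T. z T \<noteq> 0 \<Longrightarrow> card T = j"
    and dz: "\<And>T. contract var z T \<in> seq_ideal as k"
    and nb: "\<And>v. (\<And>T. v T \<in> supported E) \<Longrightarrow> (\<And>T. z T - contract var v T \<in> seq_ideal as k) \<Longrightarrow> False"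
    unfolding koszul_class_def by blast+
  have homotopy: "contract var (wedge b z) T = as ! k * z T - wedge b (contract var z) T" for T
    using contract_wedge_homotopy[of var b z T] unfolding b by (simp add: algebra_simps)
  have hdz: "wedge b (contract var z) T \<in> seq_ideal as k" for T
    by (rule ideal_like_wedge[OF N dz])
  have "koszul_class (seq_ideal as (Suc k)) (Suc j) (wedge b z)"
    unfolding koszul_class_def
  proof (intro conjI allI impI notI)
    show "wedge b z T \<in> supported E" for T by (rule ideal_like_wedge[OF ideal_E zE])
    show "card T = Suc j" if "wedge b z T \<noteq> 0" for T by (rule wedge_supported[OF zj that])
    show "contract var (wedge b z) T \<in> seq_ideal as (Suc k)" for T
    proof -
      have "contract var (wedge b z) T = - wedge b (contract var z) T + as ! k * z T"
        by (simp add: homotopy)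
      then show ?thesis
        unfolding seq_ideal_Suc using ideal_like_uminus[OF N hdz] zE by blast
    qed
  next
    assume "\<exists>v. (\<forall>T. v T \<in> supported E) \<and> (\<forall>T. wedge b z T - contract var v T \<in> seq_ideal as (Suc k))"
    then obtain v where "\<And>T. wedge b z T - contract var v T \<in> seq_ideal as (Suc k)" by blast
    then have "\<exists>g t. g \<in> seq_ideal as k \<and> t \<in> supported E \<and> wedge b z T - contract var v T = g + as ! k * t" for T
      unfolding seq_ideal_Suc by blast
    then obtain g t where g: "\<And>T. g T \<in> seq_ideal as k" and t: "\<And>T. t T \<in> supported E"
      and eq: "\<And>T. wedge b z T - contract var v T = g T + as ! k * t T"
      by metis
    have "wedge b z = (\<lambda>T. contract var v T + (g T + as ! k * t T))"
      using eq by (intro ext) (simp add: algebra_simps)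
    \<comment> \<open>The boundary of \<open>v\<close> is killed by the differential. Comparison
      with the homotopy formula puts \<open>as ! k\<close> times \<open>z - contract var t\<close>
      into \<open>seq_ideal as k\<close>, and regularity then makes \<open>z\<close> the boundary of
      \<open>t\<close>, a contradiction.\<close>
    then have "contract var (wedge b z) T = contract var g T + as ! k * contract var t T" for T
      by (simp only: contract_add contract_scale contract_contract) simp
    then have "as ! k * (z T - contract var t T) = contract var g T + wedge b (contract var z) T" for T
      using homotopy[of T] by (simp add: right_diff_distrib) (simp add: algebra_simps)
    then have "as ! k * (z T - contract var t T) \<in> seq_ideal as k" for T
      using ideal_like_add[OF N ideal_like_contract[OF N g] hdz] by (simp only:)
    moreover have "z T - contract var t T \<in> supported E" for T
      by (intro ideal_like_diff[OF ideal_E] zE ideal_like_contract[OF ideal_E] t)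
    ultimately have "z T - contract var t T \<in> seq_ideal as k" for T
      by (rule regular[rotated])
    with t show False by (rule nb)
  qed
  then show ?thesis by blast
qed

lemma regular_sequence_length:
  assumes z: "koszul_class (supported F) j z"
    and as: "regular_sequence mpoly_ring M as" "set as \<subseteq> irrelevant_ideal"
  shows "j + length as \<le> card (UNIV :: 'n set)"
proof -
  have *: "\<exists>w. koszul_class (seq_ideal as k) (j + k) w" if "k \<le> length as" for k
    using that
  proof (induction k)
    case 0
    then show ?case using z seq_ideal_0 by auto
  next
    case (Suc k)
    then obtain w where w: "koszul_class (seq_ideal as k) (j + k) w" by auto
    have "f \<in> seq_ideal as k" if "f \<in> supported E" "as ! k * f \<in> seq_ideal as k" for f
    proof -
      have "p (as ! k * f) \<in> list_smult mpoly_ring (take k as) M"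
        using p_in_list_smult_iff[of k as "as ! k * f"] Suc.prems that
        by (simp add: ideal_like_mult[OF ideal_E])
      then have "as ! k \<odot>\<^bsub>M\<^esub> p f \<in> list_smult mpoly_ring (take k as) M"
        using p_smult that by simp
      moreover have "p f \<in> carrier M" using that carrier_eq by simp
      ultimately have "p f \<in> list_smult mpoly_ring (take k as) M"
        using as(1) Suc.prems by (simp add: regular_sequence_def)
      then show ?thesis using p_in_list_smult_iff[of k as f] Suc.prems that by simp
    qed
    moreover have "as ! k \<in> irrelevant_ideal" using as(2) Suc.prems by auto
    ultimately show ?case using koszul_class_step[OF w] by simp
  qed
  obtain w where w: "koszul_class (seq_ideal as (length as)) (j + length as) w"
    using *[of "length as"] by auto
  \<comment> \<open>A zero representative would be the boundary of zero. A nonzero coefficient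
    exhibits \<open>j + length as\<close> distinct variables.\<close>
  have "\<exists>T. w T \<noteq> 0"
  proof (rule ccontr)
    assume "\<not> (\<exists>T. w T \<noteq> 0)"
    moreover have "contract var (\<lambda>_. 0 :: ('n, 'k) mpoly) T = 0" for T by (simp add: contract_def)
    ultimately have "\<forall>T. w T - contract var (\<lambda>_. 0) T \<in> seq_ideal as (length as)"
      using ideal_like_zero[OF ideal_like_seq_ideal] by simp
    moreover have "\<forall>T :: 'n set. (\<lambda>_. 0 :: ('n, 'k) mpoly) T \<in> supported E"
      using ideal_like_zero[OF ideal_E] by simp
    ultimately have "\<exists>v. (\<forall>T. v T \<in> supported E) \<and>
        (\<forall>T. w T - contract var v T \<in> seq_ideal as (length as))"
      by (intro exI[of _ "\<lambda>_. 0"] conjI)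
    then show False using w unfolding koszul_class_def by simp
  qed
  then obtain T where "w T \<noteq> 0" by blast
  then have "card T = j + length as" using w unfolding koszul_class_def by blast
  then show ?thesis using card_mono[of UNIV T] by simp
qed

lemma depth_le:
  assumes "koszul_class (supported F) j z"
  shows "depth mpoly_ring irrelevant_ideal M \<le> enat (card (UNIV :: 'n set) - j)"
  unfolding depth_def
proof (rule Sup_least)
  fix x assume "x \<in> {enat (length as) |as. set as \<subseteq> irrelevant_ideal \<and> regular_sequence mpoly_ring M as}"
  then obtain as where as: "x = enat (length as)" "set as \<subseteq> irrelevant_ideal" "regular_sequence mpoly_ring M as"
    by blast
  with regular_sequence_length[OF assms as(3,2)] show "x \<le> enat (card (UNIV :: 'n set) - j)" by simp
qed

end

section \<open>Stanley decompositions from cone partitions\<close>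

lemma cone_add: "Poly_Mapping.keys s \<subseteq> Z \<Longrightarrow> t + s \<in> cone t Z"
  by (auto simp: cone_def upset_def lookup_add in_keys_iff)

lemma cone_diff:
  assumes "s \<in> cone t Z"
  shows "t + (s - t) = s" "Poly_Mapping.keys (s - t) \<subseteq> Z"
proof -
  have le: "Poly_Mapping.lookup t i \<le> Poly_Mapping.lookup s i" for i
    using assms by (simp add: cone_def upset_def)
  show "t + (s - t) = s"
    by (rule poly_mapping_eqI) (simp add: lookup_add lookup_minus le)
  have "Poly_Mapping.lookup (s - t) i = 0" if "i \<notin> Z" for i
    using assms that by (simp add: cone_def lookup_minus)
  then show "Poly_Mapping.keys (s - t) \<subseteq> Z" by (auto simp: in_keys_iff)
qed

lemma base_in_cone: "t \<in> cone t Z"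
  by (simp add: cone_def upset_def)

text \<open>Inside the cone, the truncated subtraction \<open>s - t\<close> is true division of
  monomials, so every term can be divided by the base monomial and leaves only variables of
  \<open>Z\<close>.\<close>

lemma polys_in_mult_xpow:
  "(\<lambda>f. f * Poly_Mapping.single t 1) ` polys_in Z = (supported (cone t Z) :: ('n::finite, 'k::field) mpoly set)"
proof (intro equalityI subsetI)
  fix g :: "('n, 'k) mpoly" assume "g \<in> (\<lambda>f. f * Poly_Mapping.single t 1) ` polys_in Z"
  then obtain f where f: "f \<in> polys_in Z" and g: "g = Poly_Mapping.single t 1 * f"
    by (auto simp: mult.commute)
  have "(+) t ` Poly_Mapping.keys f \<subseteq> cone t Z"
    using f by (auto simp: polys_in_def intro: cone_add)
  then show "g \<in> supported (cone t Z)"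
    using keys_single_mult[of t 1 f] unfolding g supported_def by blast
next
  fix g :: "('n, 'k) mpoly" assume "g \<in> supported (cone t Z)"
  then have g: "s \<in> cone t Z" if "s \<in> Poly_Mapping.keys g" for s
    using that by (auto simp: supported_def)
  define f where "f = (\<Sum>s\<in>Poly_Mapping.keys g. Poly_Mapping.single (s - t) (Poly_Mapping.lookup g s))"
  have "f * Poly_Mapping.single t 1 = (\<Sum>s\<in>Poly_Mapping.keys g. Poly_Mapping.single s (Poly_Mapping.lookup g s))"
    unfolding f_def sum_distrib_right
    by (intro sum.cong refl) (simp add: mult_single add.commute[of _ t] cone_diff(1)[OF g])
  also have "\<dots> = g" by (rule poly_mapping_sum_single[symmetric])
  finally have "g = f * Poly_Mapping.single t 1" ..
  moreover have "f \<in> polys_in Z"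
  proof -
    have "Poly_Mapping.keys f \<subseteq> (\<Union>s\<in>Poly_Mapping.keys g. Poly_Mapping.keys (Poly_Mapping.single (s - t) (Poly_Mapping.lookup g s)))"
      unfolding f_def by (rule Poly_Mapping.keys_sum)
    also have "\<dots> \<subseteq> (\<lambda>s. s - t) ` Poly_Mapping.keys g" by (auto split: if_splits)
    finally show ?thesis
      using cone_diff(2)[OF g] unfolding polys_in_def by blast
  qed
  ultimately show "g \<in> (\<lambda>f. f * Poly_Mapping.single t 1) ` polys_in Z" by blast
qed

lemma mult_xpow_eq_0:
  fixes f :: "('n::finite, 'k::field) mpoly"
  assumes "f * Poly_Mapping.single t 1 = 0"
  shows "f = 0"
proof (rule poly_mapping_eqI)
  fix s
  have "Poly_Mapping.lookup f s = Poly_Mapping.lookup (f * Poly_Mapping.single t 1) (t + s)"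
    using lookup_single_mult_add[of t 1 f s] by (simp add: mult.commute)
  then show "Poly_Mapping.lookup f s = Poly_Mapping.lookup 0 s" using assms by simp
qed

lemma supported_iff: "f \<in> supported E \<longleftrightarrow> (\<forall>t. t \<notin> E \<longrightarrow> Poly_Mapping.lookup f t = 0)"
  by (auto simp: supported_def in_keys_iff)

definition poly_restrict :: "('n \<Rightarrow>\<^sub>0 nat) set \<Rightarrow> ('n, 'k::field) mpoly \<Rightarrow> ('n, 'k) mpoly"
  where "poly_restrict A f = (\<Sum>t\<in>Poly_Mapping.keys f \<inter> A. Poly_Mapping.single t (Poly_Mapping.lookup f t))"

lemma lookup_poly_restrict:
  "Poly_Mapping.lookup (poly_restrict A f) s = (if s \<in> A then Poly_Mapping.lookup f s else 0)"
proof -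
  have "Poly_Mapping.lookup (poly_restrict A f) s
      = (\<Sum>t\<in>Poly_Mapping.keys f \<inter> A. if t = s then Poly_Mapping.lookup f t else 0)"
    by (simp add: poly_restrict_def lookup_sum lookup_single when_def)
  also have "\<dots> = (if s \<in> A then Poly_Mapping.lookup f s else 0)" by (simp add: in_keys_iff)
  finally show ?thesis .
qed

context monomial_subquotient
begin

lemma stanley_space_eq:
  assumes "t \<in> E"
  shows "stanley_space M (p (Poly_Mapping.single t 1), Z) = p ` supported (cone t Z)"
proof -
  have "f \<odot>\<^bsub>M\<^esub> p (Poly_Mapping.single t 1) = p (f * Poly_Mapping.single t 1)" for f
    using assms by (simp add: p_smult)
  then have "stanley_space M (p (Poly_Mapping.single t 1), Z)
      = p ` (\<lambda>f. f * Poly_Mapping.single t 1) ` polys_in Z"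
    by (simp add: stanley_space_def image_image)
  then show ?thesis by (simp only: polys_in_mult_xpow)
qed

text \<open>The product of \<open>f - g\<close> with the monomial is supported both in
  \<open>F\<close> and in a cone disjoint from \<open>F\<close>, hence is zero; a monomial is a
  nonzerodivisor.\<close>

lemma stanley_free:
  assumes "cone t Z \<subseteq> E - F"
  shows "inj_on (\<lambda>f. f \<odot>\<^bsub>M\<^esub> p (Poly_Mapping.single t 1)) (polys_in Z)"
proof (rule inj_onI)
  have t: "(Poly_Mapping.single t 1 :: ('n, 'k) mpoly) \<in> supported E"
    using assms base_in_cone[of t Z] by auto
  fix f g :: "('n, 'k) mpoly" assume fg: "f \<in> polys_in Z" "g \<in> polys_in Z"
    and eq: "f \<odot>\<^bsub>M\<^esub> p (Poly_Mapping.single t 1) = g \<odot>\<^bsub>M\<^esub> p (Poly_Mapping.single t 1)"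
  have "p (f * Poly_Mapping.single t 1) = p (g * Poly_Mapping.single t 1)"
    using eq p_smult[OF t] by simp
  then have "(f - g) * Poly_Mapping.single t 1 \<in> supported F"
    using p_eq_iff ideal_like_mult[OF ideal_E t] by (simp add: left_diff_distrib)
  moreover have "(f - g) * Poly_Mapping.single t 1 \<in> supported (cone t Z)"
  proof -
    have "Poly_Mapping.keys (f - g) \<subseteq> Poly_Mapping.keys f \<union> Poly_Mapping.keys g"
      by (auto simp: in_keys_iff lookup_minus)
    then have "f - g \<in> polys_in Z" using fg by (auto simp: polys_in_def)
    then show ?thesis using polys_in_mult_xpow by blast
  qed
  ultimately have "(f - g) * Poly_Mapping.single t 1 = 0"
    using assms by (intro poly_mapping_eqI) (simp add: supported_iff, blast)
  then show "f = g" using mult_xpow_eq_0 by fastforce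
qed

text \<open>Coefficients off \<open>F\<close> depend only on the residue class, and each exponent of
  \<open>E - F\<close> belongs to exactly one \<open>C i\<close>; so the summands can be recovered.
  Conversely, the restrictions of a polynomial to the sets \<open>C i\<close> add up to it modulo
  \<open>supported F\<close>.\<close>

lemma bij_betw_direct_sum:
  fixes C :: "nat \<Rightarrow> ('n \<Rightarrow>\<^sub>0 nat) set"
  assumes disj: "\<And>i j. i < n \<Longrightarrow> j < n \<Longrightarrow> i \<noteq> j \<Longrightarrow> C i \<inter> C j = {}"
    and union: "(\<Union>i<n. C i) = E - F"
  shows "bij_betw (\<lambda>w. \<Oplus>\<^bsub>M\<^esub>i\<in>{..<n}. w i) (\<Pi>\<^sub>E i\<in>{..<n}. p ` supported (C i)) (carrier M)"
proof (rule bij_betw_imageI)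
  have CE: "supported (C i) \<subseteq> supported E" if "i < n" for i
    using that union by (intro supported_mono) auto
  have rep: "\<exists>g. \<forall>i<n. g i \<in> supported (C i) \<and> w i = p (g i)"
    if "w \<in> (\<Pi>\<^sub>E i\<in>{..<n}. p ` supported (C i))" for w
  proof -
    have "\<forall>i<n. \<exists>g. g \<in> supported (C i) \<and> w i = p g" using that by (auto simp: PiE_iff)
    then show ?thesis by metis
  qed
  have coeff: "Poly_Mapping.lookup (\<Sum>j<n. g j) s = Poly_Mapping.lookup (g i) s"
    if "\<And>j. j < n \<Longrightarrow> g j \<in> supported (C j)" "i < n" "s \<in> C i" for g :: "nat \<Rightarrow> ('n, 'k) mpoly" and i s
  proof -
    have "Poly_Mapping.lookup (\<Sum>j<n. g j) s = (\<Sum>j<n. if j = i then Poly_Mapping.lookup (g j) s else 0)"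
      unfolding lookup_sum
    proof (intro sum.cong refl)
      fix j assume j: "j \<in> {..<n}"
      show "Poly_Mapping.lookup (g j) s = (if j = i then Poly_Mapping.lookup (g j) s else 0)"
      proof (cases "j = i")
        case False
        then have "s \<notin> C j" using disj[of i j] that(2,3) j by auto
        then show ?thesis using that(1)[of j] j False by (simp add: supported_iff)
      qed simp
    qed
    then show ?thesis using that(2) by simp
  qed
  show "inj_on (\<lambda>w. \<Oplus>\<^bsub>M\<^esub>i\<in>{..<n}. w i) (\<Pi>\<^sub>E i\<in>{..<n}. p ` supported (C i))"
  proof (rule inj_onI)
    fix v w assume v: "v \<in> (\<Pi>\<^sub>E i\<in>{..<n}. p ` supported (C i))"
      and w: "w \<in> (\<Pi>\<^sub>E i\<in>{..<n}. p ` supported (C i))"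
      and eq: "(\<Oplus>\<^bsub>M\<^esub>i\<in>{..<n}. v i) = (\<Oplus>\<^bsub>M\<^esub>i\<in>{..<n}. w i)"
    obtain f where f: "\<And>i. i < n \<Longrightarrow> f i \<in> supported (C i)" "\<And>i. i < n \<Longrightarrow> v i = p (f i)"
      using rep[OF v] by blast
    obtain g where g: "\<And>i. i < n \<Longrightarrow> g i \<in> supported (C i)" "\<And>i. i < n \<Longrightarrow> w i = p (g i)"
      using rep[OF w] by blast
    have fE: "f i \<in> supported E" and gE: "g i \<in> supported E" if "i < n" for i
      using f(1)[OF that] g(1)[OF that] CE[OF that] by blast+
    have "p (\<Sum>i<n. f i) = p (\<Sum>i<n. g i)"
      using eq finsum_eq[of "{..<n}" f v] finsum_eq[of "{..<n}" g w] fE gE f(2) g(2) by simp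
    moreover have "(\<Sum>i<n. f i) \<in> supported E" "(\<Sum>i<n. g i) \<in> supported E"
      by (rule ideal_like_sum[OF ideal_E]; use fE gE in simp)+
    ultimately have F: "(\<Sum>i<n. f i) - (\<Sum>i<n. g i) \<in> supported F"
      using p_eq_iff by blast
    have "f i = g i" if i: "i < n" for i
    proof (rule poly_mapping_eqI)
      fix s
      show "Poly_Mapping.lookup (f i) s = Poly_Mapping.lookup (g i) s"
      proof (cases "s \<in> C i")
        case True
        then have "s \<notin> F" using union i by blast
        then have "Poly_Mapping.lookup (\<Sum>i<n. f i) s = Poly_Mapping.lookup (\<Sum>i<n. g i) s"
          using F by (simp add: supported_iff lookup_minus)
        then show ?thesis using coeff[OF f(1) i True] coeff[OF g(1) i True] by simp
      next
        case False
        then show ?thesis using f(1)[OF i] g(1)[OF i] by (simp add: supported_iff)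
      qed
    qed
    then show "v = w"
      using f(2) g(2) by (intro PiE_ext[OF v w]) simp
  qed
  show "(\<lambda>w. \<Oplus>\<^bsub>M\<^esub>i\<in>{..<n}. w i) ` (\<Pi>\<^sub>E i\<in>{..<n}. p ` supported (C i)) = carrier M"
  proof (intro equalityI subsetI)
    fix m assume "m \<in> (\<lambda>w. \<Oplus>\<^bsub>M\<^esub>i\<in>{..<n}. w i) ` (\<Pi>\<^sub>E i\<in>{..<n}. p ` supported (C i))"
    then obtain w where w: "w \<in> (\<Pi>\<^sub>E i\<in>{..<n}. p ` supported (C i))"
      and m: "m = (\<Oplus>\<^bsub>M\<^esub>i\<in>{..<n}. w i)" by blast
    obtain g where g: "\<And>i. i < n \<Longrightarrow> g i \<in> supported (C i)" "\<And>i. i < n \<Longrightarrow> w i = p (g i)"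
      using rep[OF w] by blast
    have gE: "g i \<in> supported E" if "i < n" for i using g(1)[OF that] CE[OF that] by blast
    have "m = p (\<Sum>i<n. g i)" unfolding m by (rule finsum_eq) (use gE g(2) in auto)
    moreover have "(\<Sum>i<n. g i) \<in> supported E" by (rule ideal_like_sum[OF ideal_E]) (use gE in auto)
    ultimately show "m \<in> carrier M" using carrier_eq by blast
  next
    fix m assume "m \<in> carrier M"
    then obtain f where f: "f \<in> supported E" and m: "m = p f" using carrier_eq by blast
    define g where "g i = poly_restrict (C i) f" for i
    have g: "g i \<in> supported (C i)" for i
      by (simp add: g_def supported_iff lookup_poly_restrict)
    have gE: "g i \<in> supported E" if "i < n" for i using g CE[OF that] by blast
    have sumE: "(\<Sum>i<n. g i) \<in> supported E" by (rule ideal_like_sum[OF ideal_E]) (use gE in auto)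
    define w where "w = restrict (\<lambda>i. p (g i)) {..<n}"
    have "(\<Oplus>\<^bsub>M\<^esub>i\<in>{..<n}. w i) = p (\<Sum>i<n. g i)"
      by (rule finsum_eq) (use gE in \<open>auto simp: w_def\<close>)
    also have "\<dots> = p f"
    proof -
      have "Poly_Mapping.lookup (\<Sum>i<n. g i) s = Poly_Mapping.lookup f s" if s: "s \<notin> F" for s
      proof (cases "s \<in> E")
        case True
        then obtain i where i: "i < n" "s \<in> C i" using union s by blast
        then show ?thesis
          using coeff[of g i s] g by (simp add: g_def lookup_poly_restrict)
      next
        case False
        then show ?thesis using f sumE by (simp add: supported_iff)
      qed
      then have "(\<Sum>i<n. g i) - f \<in> supported F" by (simp add: supported_iff lookup_minus)
      then show ?thesis using p_eq_iff[OF sumE f] by simp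
    qed
    finally have "m = (\<Oplus>\<^bsub>M\<^esub>i\<in>{..<n}. w i)" using m by simp
    moreover have "w \<in> (\<Pi>\<^sub>E i\<in>{..<n}. p ` supported (C i))" using g by (auto simp: w_def)
    ultimately show "m \<in> (\<lambda>w. \<Oplus>\<^bsub>M\<^esub>i\<in>{..<n}. w i) ` (\<Pi>\<^sub>E i\<in>{..<n}. p ` supported (C i))"
      by blast
  qed
qed

lemma sdepth_ge:
  assumes "coned_dim k (E - F)" and "E - F \<noteq> {}"
    and gr: "\<And>t. \<exists>a. t \<in> E \<longrightarrow> p (Poly_Mapping.single t 1) \<in> gr a"
  shows "k \<le> sdepth M gr"
proof -
  obtain D where D: "\<And>i. i < length D \<Longrightarrow> k \<le> card (snd (D ! i))"
    "\<And>i j. i < length D \<Longrightarrow> j < length D \<Longrightarrow> i \<noteq> j \<Longrightarrow>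
      cone (fst (D ! i)) (snd (D ! i)) \<inter> cone (fst (D ! j)) (snd (D ! j)) = {}"
    "E - F = (\<Union>i<length D. cone (fst (D ! i)) (snd (D ! i)))"
    using coned_list[OF assms(1)] by blast
  define D' where "D' = map (\<lambda>(t, Z). (p (Poly_Mapping.single t 1), Z)) D"
  have len: "length D' = length D" by (simp add: D'_def)
  have nth: "D' ! i = (p (Poly_Mapping.single (fst (D ! i)) 1), snd (D ! i))" if "i < length D" for i
    using that by (simp add: D'_def case_prod_beta)
  have sub: "cone (fst (D ! i)) (snd (D ! i)) \<subseteq> E - F" if "i < length D" for i
    using D(3) that by blast
  have base: "fst (D ! i) \<in> E" if "i < length D" for i
    using sub[OF that] base_in_cone[of "fst (D ! i)" "snd (D ! i)"] by blast
  have "stanley_decomposition M gr D'"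
    unfolding stanley_decomposition_def
  proof
    show "\<forall>(m, Z)\<in>set D'. m \<in> carrier M \<and> (\<exists>a. m \<in> gr a) \<and> inj_on (\<lambda>f. f \<odot>\<^bsub>M\<^esub> m) (polys_in Z)"
    proof (rule ballI)
      fix x assume "x \<in> set D'"
      then obtain i where i: "i < length D" and x: "x = D' ! i" by (auto simp: in_set_conv_nth len)
      have "p (Poly_Mapping.single (fst (D ! i)) 1) \<in> carrier M"
        unfolding carrier_eq by (rule imageI) (simp only: xpow_in_supported base[OF i])
      moreover have "\<exists>a. p (Poly_Mapping.single (fst (D ! i)) 1) \<in> gr a" using gr base[OF i] by blast
      ultimately show "case x of (m, Z) \<Rightarrow> m \<in> carrier M \<and> (\<exists>a. m \<in> gr a) \<and> inj_on (\<lambda>f. f \<odot>\<^bsub>M\<^esub> m) (polys_in Z)"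
        using stanley_free[OF sub[OF i]] by (simp add: x nth[OF i])
    qed
    have "stanley_space M (D' ! i) = p ` supported (cone (fst (D ! i)) (snd (D ! i)))" if "i < length D" for i
      using nth[OF that] stanley_space_eq[OF base[OF that]] by simp
    then have "(\<Pi>\<^sub>E i\<in>{..<length D'}. stanley_space M (D' ! i))
        = (\<Pi>\<^sub>E i\<in>{..<length D}. p ` supported (cone (fst (D ! i)) (snd (D ! i))))"
      unfolding len by (intro PiE_cong) auto
    then show "bij_betw (\<lambda>w. \<Oplus>\<^bsub>M\<^esub>i\<in>{..<length D'}. w i) (\<Pi>\<^sub>E i\<in>{..<length D'}. stanley_space M (D' ! i)) (carrier M)"
      using bij_betw_direct_sum[of "length D" "\<lambda>i. cone (fst (D ! i)) (snd (D ! i))"] D(2,3)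
      by (simp add: len)
  qed
  then have mem: "sdepth_decomposition D' \<in> {sdepth_decomposition D | D. stanley_decomposition M gr D}" by blast
  have "D \<noteq> []" using assms(2) D(3) by auto
  have "sdepth_decomposition D' \<ge> k"
    unfolding sdepth_decomposition_def
  proof (rule Min.boundedI)
    show "(\<lambda>(m, Z). card Z) ` set D' \<noteq> {}" using \<open>D \<noteq> []\<close> by (simp add: D'_def)
    fix c assume "c \<in> (\<lambda>(m, Z). card Z) ` set D'"
    then obtain i where "i < length D" "c = card (snd (D' ! i))" by (auto simp: in_set_conv_nth len case_prod_beta)
    then show "k \<le> c" using D(1) nth by simp
  qed simp
  also have "sdepth_decomposition D' \<le> sdepth M gr"
    unfolding sdepth_def
  proof (rule Max_ge[OF _ mem])
    \<comment> \<open>\<open>Max\<close> needs a finite set. Nonempty lists are bounded by the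
      number of variables, and the empty list has the unspecified value \<open>Min {}\<close>, which
      is added separately.\<close>
    have "sdepth_decomposition L \<in> insert (Min {}) {..card (UNIV :: 'n set)}" for L :: "('m \<times> 'n set) list"
    proof (cases "L = []")
      case False
      define x where "x = hd L"
      have x: "x \<in> set L" using False by (simp add: x_def)
      then have "sdepth_decomposition L \<le> card (snd x)"
        unfolding sdepth_decomposition_def by (intro Min_le) (auto simp: case_prod_beta)
      also have "\<dots> \<le> card (UNIV :: 'n set)" by (rule card_mono) auto
      finally show ?thesis by simp
    qed (simp add: sdepth_decomposition_def)
    then have "{sdepth_decomposition D | D. stanley_decomposition M gr D} \<subseteq> insert (Min {}) {..card (UNIV :: 'n set)}"
      by blast
    then show "finite {sdepth_decomposition D | D. stanley_decomposition M gr D}"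
      by (rule finite_subset) simp
  qed
  finally show ?thesis .
qed

end

section \<open>Monomial ideals and their minimal generators\<close>

lemma supported_UNIV: "supported UNIV = (UNIV :: ('n::finite, 'k::field) mpoly set)"
  by (simp add: supported_def)

lemma supported_empty: "supported {} = ({0} :: ('n::finite, 'k::field) mpoly set)"
  by (auto simp: supported_def)

lemma upclosed_UNIV: "upclosed UNIV" and upclosed_empty: "upclosed {}"
  by (simp_all add: upclosed_def)

lemma ideal_module_subquotient:
  assumes "upclosed E"
  shows "monomial_subquotient E {}
    (ideal_module mpoly_ring (supported E :: ('n::finite, 'k::field) mpoly set)) (\<lambda>f. f)"
proof (rule monomial_subquotient.intro)
  let ?I = "supported E :: ('n, 'k) mpoly set"
  have I: "ideal_like ?I" by (rule ideal_like_supported[OF assms])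
  show "abelian_monoid (ideal_module mpoly_ring ?I)"
    by (rule abelian_monoidI)
       (simp_all add: ideal_module_def ideal_like_add[OF I] ideal_like_zero[OF I] algebra_simps)
qed (use assms in \<open>auto simp: ideal_module_def supported_empty upclosed_empty\<close>)

lemma quotient_module_subquotient:
  assumes "upclosed F"
  shows "monomial_subquotient UNIV F
    (quotient_module mpoly_ring (supported F :: ('n::finite, 'k::field) mpoly set))
    (\<lambda>f. supported F +>\<^bsub>mpoly_ring\<^esub> f)"
proof (rule monomial_subquotient.intro)
  let ?R = "mpoly_ring :: ('n, 'k) mpoly ring"
  let ?I = "supported F :: ('n, 'k) mpoly set"
  have I: "ideal_like ?I" by (rule ideal_like_supported[OF assms])
  interpret ideal ?I ?R by (rule ideal_mpoly_ring[OF I])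
  interpret Q: ring "?R Quot ?I" by (rule quotient_is_ring)
  show "abelian_monoid (quotient_module ?R ?I)"
    by (rule abelian_monoidI) (simp_all add: quotient_module_def Q.a_ac)
  show "carrier (quotient_module ?R ?I) = (\<lambda>f. ?I +>\<^bsub>?R\<^esub> f) ` supported UNIV"
    by (auto simp: quotient_module_def FactRing_def A_RCOSETS_def' supported_UNIV)
  show "?I +>\<^bsub>?R\<^esub> 0 = \<zero>\<^bsub>quotient_module ?R ?I\<^esub>"
    by (auto simp: quotient_module_def FactRing_def a_r_coset_def')
  show "?I +>\<^bsub>?R\<^esub> (f + g) = (?I +>\<^bsub>?R\<^esub> f) \<oplus>\<^bsub>quotient_module ?R ?I\<^esub> (?I +>\<^bsub>?R\<^esub> g)" for f g
    using a_rcos_sum[of f g] by (simp add: quotient_module_def FactRing_def)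
  show "?I +>\<^bsub>?R\<^esub> (c * f) = c \<odot>\<^bsub>quotient_module ?R ?I\<^esub> (?I +>\<^bsub>?R\<^esub> f)" for c f
    using rcoset_mult_add[of c f] by (simp add: quotient_module_def FactRing_def)
  show "(?I +>\<^bsub>?R\<^esub> f = ?I +>\<^bsub>?R\<^esub> g) \<longleftrightarrow> f - g \<in> ?I" for f g
  proof
    assume "?I +>\<^bsub>?R\<^esub> f = ?I +>\<^bsub>?R\<^esub> g"
    moreover have "f \<in> ?I +>\<^bsub>?R\<^esub> f" using ideal_like_zero[OF I] by (auto simp: a_r_coset_def')
    ultimately obtain h where "h \<in> ?I" "f = h + g" by (auto simp: a_r_coset_def')
    then show "f - g \<in> ?I" by simp
  next
    assume fg: "f - g \<in> ?I"
    show "?I +>\<^bsub>?R\<^esub> f = ?I +>\<^bsub>?R\<^esub> g"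
    proof (intro equalityI subsetI)
      fix x assume "x \<in> ?I +>\<^bsub>?R\<^esub> f"
      then obtain h where "h \<in> ?I" "x = h + f" by (auto simp: a_r_coset_def')
      then have "h + (f - g) \<in> ?I" "x = (h + (f - g)) + g" using ideal_like_add[OF I _ fg] by simp_all
      then have "\<exists>h'\<in>?I. x = h' + g" by blast
      then show "x \<in> ?I +>\<^bsub>?R\<^esub> g" by (auto simp: a_r_coset_def')
    next
      fix x assume "x \<in> ?I +>\<^bsub>?R\<^esub> g"
      then obtain h where "h \<in> ?I" "x = h + g" by (auto simp: a_r_coset_def')
      then have "h - (f - g) \<in> ?I" "x = (h - (f - g)) + f" using ideal_like_diff[OF I _ fg] by simp_all
      then have "\<exists>h'\<in>?I. x = h' + f" by blast
      then show "x \<in> ?I +>\<^bsub>?R\<^esub> f" by (auto simp: a_r_coset_def')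
    qed
  qed
qed (use assms in \<open>auto simp: upclosed_UNIV\<close>)

lemma xpow_in_poly_grading:
  "Poly_Mapping.single t 1 \<in> poly_grading (\<lambda>i. int (Poly_Mapping.lookup t i))"
  by (simp add: poly_grading_def)

lemma ideal_grading_xpow:
  "\<exists>a. t \<in> E \<longrightarrow> Poly_Mapping.single t 1 \<in> ideal_grading (supported E) a"
  using xpow_in_poly_grading[of t] by (auto simp: ideal_grading_def simp del: keys_single)

lemma quotient_grading_xpow:
  "\<exists>a. t \<in> UNIV \<longrightarrow> I +>\<^bsub>mpoly_ring\<^esub> Poly_Mapping.single t 1 \<in> quotient_grading I a"
  using xpow_in_poly_grading[of t] by (auto simp: quotient_grading_def)

text \<open>\<open>E\<close> collects the exponents of the monomial multiples of the generators.
  Each term of a polynomial supported on \<open>E\<close> is then a multiple of a generator.\<close>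

lemma monomial_ideal_supported:
  fixes I :: "('n::finite, 'k::field) mpoly set"
  assumes "monomial_ideal I"
  obtains E where "upclosed E" "I = supported E"
proof -
  obtain T where T: "T \<subseteq> monomials" and I: "I = Idl\<^bsub>mpoly_ring\<^esub> T"
    using assms unfolding monomial_ideal_def by blast
  interpret ring "mpoly_ring :: ('n, 'k) mpoly ring" by (rule ring_from_type_algebra)
  define E where "E = {t + s | t s. (Poly_Mapping.single t 1 :: ('n, 'k) mpoly) \<in> T}"
  have E: "upclosed E"
    unfolding upclosed_def
  proof (intro ballI allI)
    fix r s assume "r \<in> E"
    then obtain t r' where "r = t + r'" "(Poly_Mapping.single t 1 :: ('n, 'k) mpoly) \<in> T" unfolding E_def by blast
    moreover then have "r + s = t + (r' + s)" by (simp add: add.assoc)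
    ultimately show "r + s \<in> E" unfolding E_def by blast
  qed
  have "T \<subseteq> supported E"
  proof
    fix f assume f: "f \<in> T"
    then obtain t where t: "f = Poly_Mapping.single t 1" using T by (auto simp: monomials_def)
    then have "t + 0 \<in> E" using f unfolding E_def by blast
    then show "f \<in> supported E" unfolding t by simp
  qed
  then have "I \<subseteq> supported E"
    unfolding I by (intro genideal_minimal ideal_mpoly_ring ideal_like_supported E)
  moreover have "supported E \<subseteq> I"
  proof
    fix f :: "('n, 'k) mpoly" assume f: "f \<in> supported E"
    have TI: "T \<subseteq> I" unfolding I by (rule genideal_self) simp
    have "ideal I (mpoly_ring :: ('n, 'k) mpoly ring)" unfolding I by (rule genideal_ideal) simp
    then have J: "ideal_like I" by (rule ideal_like_ideal)
    have "(\<Sum>s\<in>Poly_Mapping.keys f. Poly_Mapping.single s (Poly_Mapping.lookup f s)) \<in> I"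
    proof (rule ideal_like_sum[OF J])
      fix s assume "s \<in> Poly_Mapping.keys f"
      then have "s \<in> E" using f by (auto simp: supported_def)
      then obtain t r where "s = t + r" "Poly_Mapping.single t 1 \<in> T" unfolding E_def by blast
      then have "Poly_Mapping.single s (Poly_Mapping.lookup f s)
          = Poly_Mapping.single r (Poly_Mapping.lookup f s) * Poly_Mapping.single t 1"
        "Poly_Mapping.single t 1 \<in> I"
        using TI by (auto simp: mult_single add.commute)
      then show "Poly_Mapping.single s (Poly_Mapping.lookup f s) \<in> I"
        using ideal_like_mult[OF J] by simp
    qed
    then show "f \<in> I" using poly_mapping_sum_single[of f] by simp
  qed
  ultimately have "I = supported E" by (rule antisym)
  with E that show thesis by blast
qed

section \<open>Minimal exponents and Dickson's lemma\<close>

definition min_exps :: "('n::finite \<Rightarrow>\<^sub>0 nat) set \<Rightarrow> ('n \<Rightarrow>\<^sub>0 nat) set"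
  where "min_exps E = {u \<in> E. \<forall>v\<in>E. u \<in> upset v \<longrightarrow> v = u}"

lemma upset_iff_diff: "t \<in> upset u \<longleftrightarrow> (\<exists>s. t = u + s)"
proof
  assume "t \<in> upset u"
  then have "t = u + (t - u)"
    by (intro poly_mapping_eqI) (simp add: upset_def lookup_add lookup_minus)
  then show "\<exists>s. t = u + s" by blast
qed (auto simp: upset_def lookup_add)

lemma upset_refl: "u \<in> upset u"
  by (simp add: upset_def)

lemma upset_trans: "t \<in> upset u \<Longrightarrow> u \<in> upset v \<Longrightarrow> t \<in> upset v"
  unfolding upset_def by (blast intro: order_trans)

lemma xpow_dvd_iff:
  "(Poly_Mapping.single v 1 :: ('n::finite, 'k::field) mpoly) dvd Poly_Mapping.single u 1 \<longleftrightarrow> u \<in> upset v"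
proof
  assume "(Poly_Mapping.single v 1 :: ('n, 'k) mpoly) dvd Poly_Mapping.single u 1"
  then obtain f :: "('n, 'k) mpoly" where f: "Poly_Mapping.single u 1 = Poly_Mapping.single v 1 * f" by (rule dvdE)
  have "u \<in> Poly_Mapping.keys (Poly_Mapping.single u (1 :: 'k))" by simp
  then have "u \<in> (+) v ` Poly_Mapping.keys f" unfolding f using keys_single_mult by blast
  then show "u \<in> upset v" by (auto simp: upset_iff_diff)
next
  assume "u \<in> upset v"
  then obtain s where "u = v + s" by (auto simp: upset_iff_diff)
  then have "(Poly_Mapping.single u 1 :: ('n, 'k) mpoly) = Poly_Mapping.single v 1 * Poly_Mapping.single s 1"
    by (simp add: mult_single)
  then show "(Poly_Mapping.single v 1 :: ('n, 'k) mpoly) dvd Poly_Mapping.single u 1" by (rule dvdI)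
qed

lemma inj_xpow: "inj (\<lambda>t. Poly_Mapping.single t 1 :: ('n::finite, 'k::field) mpoly)"
proof (rule injI)
  fix s t assume "(Poly_Mapping.single s 1 :: ('n, 'k) mpoly) = Poly_Mapping.single t 1"
  then have "Poly_Mapping.keys (Poly_Mapping.single s 1 :: ('n, 'k) mpoly) = Poly_Mapping.keys (Poly_Mapping.single t 1 :: ('n, 'k) mpoly)"
    by (rule arg_cong)
  then show "s = t" by simp
qed

lemma min_gens_supported:
  "min_gens (supported E :: ('n::finite, 'k::field) mpoly set) = (\<lambda>t. Poly_Mapping.single t 1) ` min_exps E"
proof -
  have *: "supported E \<inter> monomials = (\<lambda>t. Poly_Mapping.single t 1 :: ('n, 'k) mpoly) ` E"
    by (auto simp: monomials_def)
  have inj: "(Poly_Mapping.single s 1 :: ('n, 'k) mpoly) = Poly_Mapping.single t 1 \<longleftrightarrow> s = t" for s t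
    using inj_xpow by (auto dest: injD)
  show ?thesis
    unfolding min_gens_def * by (auto simp: min_exps_def xpow_dvd_iff inj)
qed

lemma card_min_gens_supported:
  "card (min_gens (supported E :: ('n::finite, 'k::field) mpoly set)) = card (min_exps E)"
  unfolding min_gens_supported by (intro card_image inj_on_subset[OF inj_xpow]) simp

definition total_deg :: "('n::finite \<Rightarrow>\<^sub>0 nat) \<Rightarrow> nat"
  where "total_deg t = (\<Sum>i\<in>UNIV. Poly_Mapping.lookup t i)"

lemma total_deg_less:
  assumes "t \<in> upset u" "t \<noteq> u"
  shows "total_deg u < total_deg t"
proof -
  obtain i where "Poly_Mapping.lookup t i \<noteq> Poly_Mapping.lookup u i"
    using assms(2) by (metis poly_mapping_eqI)
  then have "Poly_Mapping.lookup u i < Poly_Mapping.lookup t i"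
    using assms(1) by (simp add: upset_def order.not_eq_order_implies_strict)
  then show ?thesis
    unfolding total_deg_def using assms(1) by (intro sum_strict_mono_ex1) (auto simp: upset_def)
qed

lemma min_exps_below:
  assumes "t \<in> E"
  shows "\<exists>u\<in>min_exps E. t \<in> upset u"
  using assms
proof (induction "total_deg t" arbitrary: t rule: less_induct)
  case less
  show ?case
  proof (cases "t \<in> min_exps E")
    case True
    then show ?thesis using upset_refl by blast
  next
    case False
    then obtain v where v: "v \<in> E" "t \<in> upset v" "v \<noteq> t"
      using less.prems by (auto simp: min_exps_def)
    then obtain u where "u \<in> min_exps E" "v \<in> upset u"
      using less.hyps[OF total_deg_less] by blast
    then show ?thesis using v upset_trans by blast
  qed
qed

lemma upclosed_eq_upsets:
  assumes "upclosed E"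
  shows "E = \<Union> (upset ` min_exps E)"
proof
  show "E \<subseteq> \<Union> (upset ` min_exps E)" using min_exps_below by blast
  show "\<Union> (upset ` min_exps E) \<subseteq> E"
    using assms by (auto simp: min_exps_def upset_iff_diff upclosed_def)
qed

text \<open>Pass to a monotone subsequence one coordinate at a time. A decreasing sequence of
  naturals is constant from the place of its minimum on, so its tail is increasing as well.\<close>

lemma exists_incseq_subsequence:
  fixes f :: "nat \<Rightarrow> 'n \<Rightarrow> nat"
  assumes "finite A"
  shows "\<exists>r. strict_mono r \<and> (\<forall>i\<in>A. incseq (\<lambda>k. f (r k) i))"
  using assms
proof (induction A rule: finite_induct)
  case empty
  show ?case by (rule exI[of _ id]) (simp add: strict_mono_def)
next
  case (insert i A)
  then obtain r where r: "strict_mono r" "\<And>j. j \<in> A \<Longrightarrow> incseq (\<lambda>k. f (r k) j)" by blast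
  have "\<exists>q :: nat \<Rightarrow> nat. strict_mono q \<and> incseq (\<lambda>k. f (r (q k)) i)"
  proof -
    obtain q :: "nat \<Rightarrow> nat" where q: "strict_mono q" "monoseq (\<lambda>k. f (r (q k)) i)"
      using seq_monosub[of "\<lambda>k. f (r k) i"] by blast
    show ?thesis
    proof (cases "incseq (\<lambda>k. f (r (q k)) i)")
      case True
      with q show ?thesis by blast
    next
      case False
      then have dec: "decseq (\<lambda>k. f (r (q k)) i)" using q(2) by (auto simp: monoseq_iff)
      obtain k0 where k0: "\<And>k. f (r (q k0)) i \<le> f (r (q k)) i"
        using ex_has_least_nat[of "\<lambda>_. True" 0 "\<lambda>k. f (r (q k)) i"] by auto
      have "f (r (q (k + k0))) i = f (r (q k0)) i" for k
        using decseqD[OF dec, of k0 "k + k0"] k0[of "k + k0"] by simp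
      then have "incseq (\<lambda>k. f (r (q (k + k0))) i)" by simp
      moreover have "strict_mono (\<lambda>k. q (k + k0))" using q(1) by (simp add: strict_mono_def)
      ultimately show ?thesis by blast
    qed
  qed
  then obtain q :: "nat \<Rightarrow> nat" where q: "strict_mono q" "incseq (\<lambda>k. f (r (q k)) i)" by blast
  have "strict_mono (\<lambda>k. r (q k))" using r(1) q(1) by (simp add: strict_mono_def)
  moreover have "incseq (\<lambda>k. f (r (q k)) j)" if "j \<in> A" for j
    using r(2)[OF that] strict_mono_mono[OF q(1)] by (simp add: mono_def)
  ultimately show ?case using q(2) by (intro exI[of _ "\<lambda>k. r (q k)"]) simp
qed

text \<open>An infinite antichain would contain two coordinatewise comparable members. Finiteness
  gives a bound on \<open>card\<close> its meaning, as \<open>card\<close> is 0 for infinite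
  sets.\<close>

lemma finite_min_exps: "finite (min_exps (E :: ('n::finite \<Rightarrow>\<^sub>0 nat) set))"
proof (rule ccontr)
  assume "infinite (min_exps E)"
  then obtain f :: "nat \<Rightarrow> 'n \<Rightarrow>\<^sub>0 nat" where f: "inj f" "range f \<subseteq> min_exps E"
    using infinite_countable_subset by blast
  obtain r where r: "strict_mono r" "\<And>i. incseq (\<lambda>k. Poly_Mapping.lookup (f (r k)) i)"
    using exists_incseq_subsequence[of UNIV "\<lambda>k i. Poly_Mapping.lookup (f k) i"] by auto
  have "f (r 1) \<in> upset (f (r 0))" using incseqD[OF r(2), of 0 1] by (simp add: upset_def)
  moreover have "f (r 1) \<in> min_exps E" "f (r 0) \<in> min_exps E" using f(2) by blast+
  ultimately have "f (r 0) = f (r 1)" by (auto simp: min_exps_def)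
  then have "r 0 = r 1" using f(1) by (auto dest: injD)
  then show False using strict_monoD[OF r(1), of 0 1] by simp
qed

section \<open>Explicit Koszul classes\<close>

definition set_exp :: "'n::finite set \<Rightarrow> 'n \<Rightarrow>\<^sub>0 nat"
  where "set_exp T = (\<Sum>i\<in>T. Poly_Mapping.single i 1)"

lemma lookup_set_exp: "Poly_Mapping.lookup (set_exp T) i = (if i \<in> T then 1 else 0)"
  by (simp add: set_exp_def lookup_sum lookup_single when_def)

text \<open>The coefficient of this polynomial at \<open>L\<close> is the pairing of the cochain \<open>q\<close> with the component
  of \<open>v\<close> of multidegree \<open>L\<close>, where the basis element of \<open>T\<close> has multidegree \<open>set_exp T\<close>.\<close>

definition koszul_pair :: "('n::finite set \<Rightarrow> 'k::field) \<Rightarrow> ('n set \<Rightarrow> ('n, 'k) mpoly) \<Rightarrow> ('n, 'k) mpoly"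
  where "koszul_pair q v = (\<Sum>T\<in>UNIV. Poly_Mapping.single (set_exp T) (q T) * v T)"

lemma koszul_pair_add: "koszul_pair q (\<lambda>T. v T + w T) = koszul_pair q v + koszul_pair q w"
  by (simp add: koszul_pair_def distrib_left sum.distrib)

lemma single_sum: "Poly_Mapping.single t (sum f A) = (\<Sum>i\<in>A. Poly_Mapping.single t (f i))"
  by (induction A rule: infinite_finite_induct) (simp_all add: single_add)

lemma ksign_mult_single:
  "ksign i T * (Poly_Mapping.single t c :: ('n::finite, 'k::field) mpoly) = Poly_Mapping.single t (ksign i T * c)"
  by (simp add: ksign_def minus_one_power_iff single_uminus)

text \<open>Weighting the coefficient of \<open>T\<close> by the product of the variables in
  \<open>T\<close> absorbs the variable in each term of the differential. What remains on scalar
  cochains is the wedge product with the constant form 1, the simplicial coboundary.\<close>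

lemma koszul_pair_contract:
  "koszul_pair q (contract var v) = koszul_pair (wedge (\<lambda>_. 1) q) (v :: 'n::finite set \<Rightarrow> ('n, 'k::field) mpoly)"
proof -
  have "wedge var (\<lambda>T. Poly_Mapping.single (set_exp T) (q T)) U
      = (Poly_Mapping.single (set_exp U) (wedge (\<lambda>_. 1) q U) :: ('n, 'k) mpoly)" for U
    unfolding wedge_def single_sum
  proof (intro sum.cong refl)
    fix i assume i: "i \<in> U"
    have "Poly_Mapping.single i 1 + set_exp (U - {i}) = set_exp U"
      using i by (simp add: set_exp_def sum.remove[of U i])
    then have "var i * (Poly_Mapping.single (set_exp (U - {i})) (q (U - {i})) :: ('n, 'k) mpoly)
        = Poly_Mapping.single (set_exp U) (q (U - {i}))"
      by (simp add: var_def mult_single)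
    then show "ksign i U * var i * (Poly_Mapping.single (set_exp (U - {i})) (q (U - {i})) :: ('n, 'k) mpoly)
        = Poly_Mapping.single (set_exp U) (ksign i U * 1 * q (U - {i}))"
      by (simp add: mult.assoc ksign_mult_single)
  qed
  then show ?thesis unfolding koszul_pair_def wedge_contract_dual by simp
qed

lemma koszul_pair_lookup_zero:
  fixes v :: "'n::finite set \<Rightarrow> ('n, 'k::field) mpoly"
  assumes v: "\<And>T. v T \<in> supported E" and q: "\<And>T t. t \<in> E \<Longrightarrow> set_exp T + t = L \<Longrightarrow> q T = 0"
  shows "Poly_Mapping.lookup (koszul_pair q v) L = 0"
  unfolding koszul_pair_def lookup_sum
proof (intro sum.neutral ballI)
  fix T
  show "Poly_Mapping.lookup (Poly_Mapping.single (set_exp T) (q T) * v T) L = 0"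
  proof (rule ccontr)
    assume *: "Poly_Mapping.lookup (Poly_Mapping.single (set_exp T) (q T) * v T) L \<noteq> 0"
    then have "L \<in> Poly_Mapping.keys (Poly_Mapping.single (set_exp T) (q T) * v T)"
      by (simp add: in_keys_iff)
    then have "L \<in> (+) (set_exp T) ` Poly_Mapping.keys (v T)"
      by (rule subsetD[OF keys_single_mult])
    then obtain t where "t \<in> E" "set_exp T + t = L" using v[of T] by (auto simp: supported_def)
    then have "q T = 0" by (rule q)
    with * show False by simp
  qed
qed

text \<open>The basis vector of \<open>A\<close> with the monomial coefficient that makes its
  multidegree \<open>L\<close>; the subtraction is a true division when \<open>A\<close> is
  contained in the keys of \<open>L\<close>.\<close>

definition koszul_basis :: "('n::finite \<Rightarrow>\<^sub>0 nat) \<Rightarrow> 'n set \<Rightarrow> 'n set \<Rightarrow> ('n, 'k::field) mpoly"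
  where "koszul_basis L A T = (if T = A then Poly_Mapping.single (L - set_exp A) 1 else 0)"

lemma koszul_pair_basis:
  assumes "A \<subseteq> Poly_Mapping.keys L"
  shows "koszul_pair q (koszul_basis L A) = Poly_Mapping.single L (q A)"
proof -
  have "koszul_pair q (koszul_basis L A)
      = (\<Sum>T\<in>UNIV. if T = A then Poly_Mapping.single (set_exp A) (q A) * Poly_Mapping.single (L - set_exp A) 1 else 0)"
    unfolding koszul_pair_def koszul_basis_def by (intro sum.cong refl) auto
  also have "\<dots> = Poly_Mapping.single (set_exp A + (L - set_exp A)) (q A)" by (simp add: mult_single)
  also have "set_exp A + (L - set_exp A) = L"
    using assms by (intro poly_mapping_eqI) (auto simp: lookup_add lookup_minus lookup_set_exp in_keys_iff)
  finally show ?thesis .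
qed

lemma contract_koszul_basis_supported:
  assumes "upclosed E" and "\<And>i. i \<in> A \<Longrightarrow> Poly_Mapping.single i 1 + (L - set_exp A) \<in> E"
  shows "contract var (koszul_basis L A) T \<in> (supported E :: ('n::finite, 'k::field) mpoly set)"
proof -
  note I = ideal_like_supported[OF assms(1)]
  show ?thesis
    unfolding contract_def
  proof (rule ideal_like_sum[OF I])
    fix i assume "i \<in> - T"
    have "var i * koszul_basis L A (insert i T) \<in> (supported E :: ('n, 'k) mpoly set)"
    proof (cases "insert i T = A")
      case True
      then have "Poly_Mapping.single i 1 + (L - set_exp A) \<in> E" using assms(2) by blast
      then show ?thesis using True by (simp add: koszul_basis_def var_def mult_single supported_def)
    next
      case False
      then show ?thesis by (simp add: koszul_basis_def ideal_like_zero[OF I])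
    qed
    then show "ksign i T * var i * koszul_basis L A (insert i T) \<in> (supported E :: ('n, 'k) mpoly set)"
      unfolding mult.assoc by (rule ideal_like_mult[OF I])
  qed
qed

text \<open>If \<open>z\<close> were the boundary of \<open>v\<close> plus a remainder in
  \<open>supported F\<close>, its pairing with \<open>q\<close> at \<open>L\<close> would be that of
  \<open>1 \<and> q\<close> with \<open>v\<close> plus that of \<open>q\<close> with the remainder.
  Both vanish term by term: \<open>q\<close> is zero where \<open>L / x_T\<close> lies in
  \<open>F\<close> and closed where it lies in \<open>E\<close>.\<close>

lemma (in monomial_subquotient) koszul_classI:
  assumes zE: "\<And>T. z T \<in> supported E" and zj: "\<And>T. z T \<noteq> 0 \<Longrightarrow> card T = j"
    and dz: "\<And>T. contract var z T \<in> supported F"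
    and pair: "Poly_Mapping.lookup (koszul_pair q z) L \<noteq> 0"
    and qF: "\<And>T t. t \<in> F \<Longrightarrow> set_exp T + t = L \<Longrightarrow> q T = 0"
    and qE: "\<And>T t. t \<in> E \<Longrightarrow> set_exp T + t = L \<Longrightarrow> wedge (\<lambda>_. 1) q T = 0"
  shows "koszul_class (supported F) j z"
  unfolding koszul_class_def
proof (intro conjI allI impI notI)
  assume "\<exists>v. (\<forall>T. v T \<in> supported E) \<and> (\<forall>T. z T - contract var v T \<in> supported F)"
  then obtain v where v: "\<And>T. v T \<in> supported E" "\<And>T. z T - contract var v T \<in> supported F" by blast
  have "koszul_pair q z = koszul_pair q (\<lambda>T. contract var v T + (z T - contract var v T))" by simp
  also have "\<dots> = koszul_pair (wedge (\<lambda>_. 1) q) v + koszul_pair q (\<lambda>T. z T - contract var v T)"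
    by (simp only: koszul_pair_add koszul_pair_contract)
  finally have "Poly_Mapping.lookup (koszul_pair q z) L = 0"
    using koszul_pair_lookup_zero[OF v(1) qE] koszul_pair_lookup_zero[OF v(2) qF] by (simp add: lookup_add)
  with pair show False by simp
qed (use zE zj dz in auto)

section \<open>Scalar cochains and criteria for nonzero classes\<close>

definition unit_form :: "'n set \<Rightarrow> 'k::field"
  where "unit_form T = (if T = {} then 1 else 0)"

lemma wedge_unit_form_singleton: "wedge c unit_form {i} = c i"
proof -
  have "ksign i {i} = (1 :: 'a)" using ksign_remove[of i i "{i}"] by (simp add: ksign_def)
  then show ?thesis by (simp add: wedge_def unit_form_def)
qed

lemma ksign_nonzero: "ksign i T \<noteq> (0 :: 'a::field)"
  using ksign_cases[of i T, where 'a='a] by auto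

lemma wedge_one_wedge:
  "wedge (\<lambda>_. 1) (wedge c z) T = wedge (\<lambda>i. 1 - c i) (wedge c z) T"
  using wedge_add_left[of "\<lambda>i. 1 - c i" c "wedge c z" T] by (simp add: wedge_self)

text \<open>Repeated factors vanish, so 1 may be replaced by \<open>1 - c - d\<close>. The product
  is therefore zero on \<open>T\<close> as soon as one of \<open>c\<close>, \<open>d\<close>,
  \<open>1 - c - d\<close> vanishes throughout \<open>T\<close>.\<close>

lemma wedge_one_wedge_wedge:
  "wedge (\<lambda>_. 1) (wedge c (wedge d z)) T = wedge (\<lambda>i. 1 - c i - d i) (wedge c (wedge d z)) T"
proof -
  have "wedge d (wedge c (wedge d z)) T = - wedge c (wedge d (wedge d z)) T" by (rule wedge_anticommute)
  also have "wedge c (wedge d (wedge d z)) T = 0" by (rule wedge_zero_right) (rule wedge_self)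
  finally have "wedge d (wedge c (wedge d z)) T = 0" by simp
  then show ?thesis
    using wedge_add_left[of "\<lambda>i. 1 - c i - d i" d "wedge c (wedge d z)" T] wedge_one_wedge[of c "wedge d z" T]
    by simp
qed

context monomial_subquotient
begin

text \<open>A minimal generator outside \<open>F\<close> gives a class in degree 0: a divisor of
  \<open>u\<close> with exponent in \<open>E\<close> is \<open>u\<close> itself, so \<open>u\<close>
  is not a combination of the variables modulo \<open>F\<close>.\<close>

lemma depth_le_card:
  assumes u: "u \<in> min_exps E" "u \<notin> F"
  shows "depth mpoly_ring irrelevant_ideal M \<le> enat (card (UNIV :: 'n set))"
proof -
  have "koszul_class (supported F) 0 (koszul_basis u {})"
  proof (rule koszul_classI[where q = unit_form and L = u])
    show "koszul_basis u {} T \<in> supported E" for T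
      using u by (auto simp: koszul_basis_def min_exps_def set_exp_def ideal_like_zero[OF ideal_E] supported_def)
    show "contract var (koszul_basis u {}) T \<in> supported F" for T
      by (rule contract_koszul_basis_supported[OF upclosed_F]) simp
    show "Poly_Mapping.lookup (koszul_pair unit_form (koszul_basis u {})) u \<noteq> 0"
      by (simp add: koszul_pair_basis unit_form_def)
    show "unit_form T = 0" if "t \<in> F" "set_exp T + t = u" for T t
      using that u by (auto simp: unit_form_def set_exp_def)
    show "wedge (\<lambda>_. 1) unit_form T = 0" if t: "t \<in> E" "set_exp T + t = u" for T t
    proof -
      have "t = u" using t u(1) by (auto simp: min_exps_def upset_iff_diff add.commute)
      then have "set_exp T = 0" using t(2) by simp
      then have "i \<notin> T" for i using lookup_set_exp[of T i] by (auto split: if_splits)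
      then have "T = {}" by blast
      then show ?thesis by (simp add: wedge_def)
    qed
  qed (simp add: koszul_basis_def split: if_splits)
  from depth_le[OF this] show ?thesis by simp
qed

text \<open>A cocycle that vanishes wherever \<open>L / x_T\<close> lies in \<open>F\<close> is a
  functional on the part of the quotient complex in multidegree \<open>L\<close>, and it is nonzero
  on the chain of \<open>A\<close>. In the applications \<open>q\<close> is a coboundary
  \<open>1 \<and> ...\<close> and closed by \<open>wedge_self\<close>.\<close>

lemma koszul_class_basis:
  fixes q :: "'n set \<Rightarrow> 'k"
  assumes A: "A \<subseteq> Poly_Mapping.keys L" and E: "L - set_exp A \<in> E"
    and cycle: "\<And>i. i \<in> A \<Longrightarrow> Poly_Mapping.single i 1 + (L - set_exp A) \<in> F"
    and q: "\<And>T. wedge (\<lambda>_. 1) q T = 0" "q A \<noteq> 0"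
    and qF: "\<And>T t. t \<in> F \<Longrightarrow> set_exp T + t = L \<Longrightarrow> q T = 0"
  shows "koszul_class (supported F) (card A) (koszul_basis L A)"
proof (rule koszul_classI[where q = q and L = L])
  show "koszul_basis L A T \<in> (supported E :: ('n, 'k) mpoly set)" for T
    using E by (simp add: koszul_basis_def ideal_like_zero[OF ideal_E])
  show "contract var (koszul_basis L A) T \<in> supported F" for T
    by (rule contract_koszul_basis_supported[OF upclosed_F cycle])
  show "Poly_Mapping.lookup (koszul_pair q (koszul_basis L A)) L \<noteq> 0"
    using q(2) by (simp add: koszul_pair_basis[OF A])
qed (use q(1) qF in \<open>auto simp: koszul_basis_def split: if_splits\<close>)

text \<open>The image of the class of \<^term>\<open>koszul_basis L A\<close> under the connecting homomorphism from \<open>S/I\<close> to \<open>I\<close>.\<close>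

lemma koszul_class_contract_basis:
  fixes q :: "'n set \<Rightarrow> 'k"
  assumes A: "A \<subseteq> Poly_Mapping.keys L" and F: "F = {}"
    and cycle: "\<And>i. i \<in> A \<Longrightarrow> Poly_Mapping.single i 1 + (L - set_exp A) \<in> E"
    and q: "wedge (\<lambda>_. 1) q A \<noteq> 0"
    and qE: "\<And>T t. t \<in> E \<Longrightarrow> set_exp T + t = L \<Longrightarrow> wedge (\<lambda>_. 1) q T = 0"
  shows "koszul_class (supported F) (card A - 1) (contract var (koszul_basis L A))"
proof (rule koszul_classI[where q = q and L = L])
  show "contract var (koszul_basis L A) T \<in> supported E" for T
    by (rule contract_koszul_basis_supported[OF upclosed_E cycle])
  show "card T = card A - 1" if "contract var (koszul_basis L A :: _ \<Rightarrow> ('n, 'k) mpoly) T \<noteq> 0" for T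
  proof -
    have "\<exists>i. i \<in> - T \<and> insert i T = A"
    proof (rule ccontr)
      assume "\<not> ?thesis"
      then have "contract var (koszul_basis L A :: _ \<Rightarrow> ('n, 'k) mpoly) T = 0"
        unfolding contract_def by (intro sum.neutral) (auto simp: koszul_basis_def)
      with that show False by simp
    qed
    then obtain i where "i \<notin> T" "insert i T = A" by auto
    then show ?thesis by auto
  qed
  show "contract var (contract var (koszul_basis L A)) T \<in> (supported F :: ('n, 'k) mpoly set)" for T
    by (simp add: contract_contract ideal_like_zero[OF ideal_F])
  show "Poly_Mapping.lookup (koszul_pair q (contract var (koszul_basis L A))) L \<noteq> 0"
    using q by (simp add: koszul_pair_contract koszul_pair_basis[OF A])
qed (use F qE in auto)

end

lemma min_exps_antisym:
  "u \<in> min_exps E \<Longrightarrow> v \<in> min_exps E \<Longrightarrow> u \<in> upset v \<Longrightarrow> v = u"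
  by (simp add: min_exps_def)

lemma not_upset_iff: "u \<notin> upset v \<longleftrightarrow> (\<exists>i. Poly_Mapping.lookup u i < Poly_Mapping.lookup v i)"
  by (auto simp: upset_def not_le)

text \<open>Two minimal generators \<open>u\<close>, \<open>v\<close> whose least common multiple \<open>L\<close> has least degree.  The cochain
  \<open>c\<close> is the indicator of the variables \<open>x\<^sub>a\<close> for which \<open>u\<close> divides \<open>L / x\<^sub>a\<close>; these form a
  connected component of the upper Koszul complex in degree \<open>L\<close>.\<close>

lemma two_generators_class:
  fixes E :: "('n::finite \<Rightarrow>\<^sub>0 nat) set"
  assumes E: "upclosed E" and card: "2 \<le> card (min_exps E)"
  obtains L A and c :: "'n \<Rightarrow> 'k::field" where
    "card A = 2" "A \<subseteq> Poly_Mapping.keys L"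
    "\<And>i. i \<in> A \<Longrightarrow> Poly_Mapping.single i 1 + (L - set_exp A) \<in> E"
    "wedge (\<lambda>_. 1) (wedge c unit_form) A \<noteq> 0"
    "\<And>T t. t \<in> E \<Longrightarrow> set_exp T + t = L \<Longrightarrow> wedge (\<lambda>_. 1) (wedge c unit_form) T = 0"
proof -
  define P where "P = (\<lambda>(u, v). u \<in> min_exps E \<and> v \<in> min_exps E \<and> u \<noteq> v)"
  have "\<exists>u v. P (u, v)"
  proof (rule ccontr)
    assume "\<not> ?thesis"
    then have "card (min_exps E) \<le> Suc 0" by (subst card_le_Suc0_iff_eq[OF finite_min_exps]) (auto simp: P_def)
    with card show False by simp
  qed
  then obtain x0 where "P x0" by blast
  then obtain x where x: "P x" "\<And>y. P y \<Longrightarrow> total_deg (exp_lcm (fst x) (snd x)) \<le> total_deg (exp_lcm (fst y) (snd y))"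
    using ex_has_least_nat[of P x0 "\<lambda>y. total_deg (exp_lcm (fst y) (snd y))"] by blast
  define u v where "u = fst x" and "v = snd x"
  have uv: "u \<in> min_exps E" "v \<in> min_exps E" "u \<noteq> v"
    using x(1) by (auto simp: P_def u_def v_def case_prod_beta)
  have least: "total_deg (exp_lcm u v) \<le> total_deg (exp_lcm u w)" if "w \<in> min_exps E" "w \<noteq> u" for w
    using x(2)[of "(u, w)"] that uv(1) by (auto simp: P_def u_def v_def)
  define L where "L = exp_lcm u v"
  obtain i where i: "Poly_Mapping.lookup u i < Poly_Mapping.lookup v i"
    using min_exps_antisym[OF uv(1,2)] uv(3) not_upset_iff by metis
  obtain j where j: "Poly_Mapping.lookup v j < Poly_Mapping.lookup u j"
    using min_exps_antisym[OF uv(2,1)] uv(3) not_upset_iff by metis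
  have ij: "i \<noteq> j" using i j by auto
  define A where "A = {i, j}"
  define c :: "'n \<Rightarrow> 'k" where "c a = (if Poly_Mapping.lookup u a < Poly_Mapping.lookup L a then 1 else 0)" for a
  show thesis
  proof
    show "card A = 2" using ij by (simp add: A_def)
    show "A \<subseteq> Poly_Mapping.keys L" using i j by (auto simp: A_def L_def in_keys_iff)
    show "Poly_Mapping.single a 1 + (L - set_exp A) \<in> E" if "a \<in> A" for a
    proof -
      \<comment> \<open>Once \<open>x_i\<close> is restored, only the exponent at \<open>j\<close>
        is below that of \<open>L\<close>, and there \<open>v\<close> is smaller than
        \<open>u\<close>.\<close>
      have "Poly_Mapping.single i 1 + (L - set_exp A) \<in> upset v"
        using i j ij by (auto simp: upset_def lookup_add lookup_minus lookup_set_exp lookup_single when_def A_def L_def)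
      moreover have "Poly_Mapping.single j 1 + (L - set_exp A) \<in> upset u"
        using i j ij by (auto simp: upset_def lookup_add lookup_minus lookup_set_exp lookup_single when_def A_def L_def)
      ultimately show ?thesis
        using that uv upclosed_eq_upsets[OF E] by (auto simp: A_def)
    qed
    have ci: "c i = 1" "c j = 0" using i j by (auto simp: c_def L_def)
    have "wedge (\<lambda>_. 1) (wedge c unit_form) A = ksign j A * (1 - c j) * wedge c unit_form (A - {j})"
      unfolding wedge_one_wedge by (rule wedge_single_term) (use ij ci in \<open>auto simp: A_def\<close>)
    also have "A - {j} = {i}" using ij by (auto simp: A_def)
    finally show "wedge (\<lambda>_. 1) (wedge c unit_form) A \<noteq> 0"
      using ci by (simp add: wedge_unit_form_singleton ksign_nonzero)
    fix T t assume t: "t \<in> E" "set_exp T + t = L"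
    obtain w where w: "w \<in> min_exps E" "t \<in> upset w" using min_exps_below[OF t(1)] by blast
    have less: "Poly_Mapping.lookup w a < Poly_Mapping.lookup L a" if "a \<in> T" for a
    proof -
      have "Poly_Mapping.lookup w a \<le> Poly_Mapping.lookup t a" using w(2) by (simp add: upset_def)
      also have "\<dots> < Poly_Mapping.lookup L a"
        using that by (simp add: t(2)[symmetric] lookup_add lookup_set_exp)
      finally show ?thesis .
    qed
    show "wedge (\<lambda>_. 1) (wedge c unit_form) T = 0"
    proof (cases "w = u")
      case True
      then have "c a = 1" if "a \<in> T" for a using less[OF that] by (simp add: c_def)
      then show ?thesis unfolding wedge_one_wedge by (intro wedge_zero_left) simp
    next
      case False
      have "L \<in> upset (exp_lcm u w)"
      proof -
        have "Poly_Mapping.lookup w a \<le> Poly_Mapping.lookup L a" for a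
          using w(2) by (auto simp: t(2)[symmetric] upset_def lookup_add intro: trans_le_add2)
        then show ?thesis by (simp add: upset_def L_def)
      qed
      \<comment> \<open>The least common multiple of \<open>u\<close> and \<open>w\<close> divides
        \<open>L\<close>, and the minimal degree of \<open>L\<close> forces equality. So
        \<open>u\<close> attains the exponent of \<open>L\<close> wherever \<open>w\<close> does
        not, and \<open>c\<close> vanishes on \<open>T\<close>.\<close>
      then have lcm: "L = exp_lcm u w"
        using total_deg_less[of L "exp_lcm u w"] least[OF w(1) False] by (force simp: L_def)
      have "c a = 0" if "a \<in> T" for a
        using less[OF that] by (simp add: c_def) (simp add: lcm max_def split: if_splits)
      then have "wedge c unit_form U = 0" if "U \<subseteq> T" for U :: "'n set"
        using that by (intro wedge_zero_left) auto
      then show ?thesis by (rule wedge_zero_right)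
    qed
  qed
qed

text \<open>The cochains \<open>c\<close>, \<open>d\<close> and \<open>1 - c - d\<close> sort the variables by the first of \<open>u\<close>, \<open>v\<close>, \<open>w\<close> with
  the same exponent as the least common multiple \<open>L\<close>.  One of them vanishes on every \<open>T\<close> with
  \<open>L / x\<^sub>T \<in> I\<close>, and so does their wedge product, which equals \<open>1 \<and> c \<and> d\<close>.\<close>

lemma three_generators_class:
  fixes u v w :: "'n::finite \<Rightarrow>\<^sub>0 nat"
  assumes u: "\<exists>i. max (Poly_Mapping.lookup v i) (Poly_Mapping.lookup w i) < Poly_Mapping.lookup u i"
    and v: "\<exists>i. max (Poly_Mapping.lookup u i) (Poly_Mapping.lookup w i) < Poly_Mapping.lookup v i"
    and w: "\<exists>i. max (Poly_Mapping.lookup u i) (Poly_Mapping.lookup v i) < Poly_Mapping.lookup w i"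
  obtains L A and c d :: "'n \<Rightarrow> 'k::field" where
    "card A = 3" "A \<subseteq> Poly_Mapping.keys L"
    "\<And>i. i \<in> A \<Longrightarrow> Poly_Mapping.single i 1 + (L - set_exp A) \<in> \<Union> (upset ` {u, v, w})"
    "wedge (\<lambda>_. 1) (wedge c (wedge d unit_form)) A \<noteq> 0"
    "\<And>T t. t \<in> \<Union> (upset ` {u, v, w}) \<Longrightarrow> set_exp T + t = L \<Longrightarrow>
      wedge (\<lambda>_. 1) (wedge c (wedge d unit_form)) T = 0"
proof -
  define L where "L = exp_lcm u (exp_lcm v w)"
  obtain i where i: "max (Poly_Mapping.lookup v i) (Poly_Mapping.lookup w i) < Poly_Mapping.lookup u i" using u by blast
  obtain j where j: "max (Poly_Mapping.lookup u j) (Poly_Mapping.lookup w j) < Poly_Mapping.lookup v j" using v by blast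
  obtain k where k: "max (Poly_Mapping.lookup u k) (Poly_Mapping.lookup v k) < Poly_Mapping.lookup w k" using w by blast
  have neq: "i \<noteq> j" "i \<noteq> k" "j \<noteq> k" using i j k by auto
  define A where "A = {i, j, k}"
  define c :: "'n \<Rightarrow> 'k" where "c a = (if Poly_Mapping.lookup u a = Poly_Mapping.lookup L a then 1 else 0)" for a
  define d :: "'n \<Rightarrow> 'k" where "d a = (if Poly_Mapping.lookup u a \<noteq> Poly_Mapping.lookup L a \<and>
      Poly_Mapping.lookup v a = Poly_Mapping.lookup L a then 1 else 0)" for a
  show thesis
  proof
    show "card A = 3" using neq by (simp add: A_def)
    show "A \<subseteq> Poly_Mapping.keys L" using i j k by (auto simp: A_def L_def in_keys_iff)
    show "Poly_Mapping.single a 1 + (L - set_exp A) \<in> \<Union> (upset ` {u, v, w})" if "a \<in> A" for a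
    proof -
      have "Poly_Mapping.single i 1 + (L - set_exp A) \<in> upset u"
        using i j k neq by (auto simp: upset_def lookup_add lookup_minus lookup_set_exp lookup_single when_def A_def L_def)
      moreover have "Poly_Mapping.single j 1 + (L - set_exp A) \<in> upset v"
        using i j k neq by (auto simp: upset_def lookup_add lookup_minus lookup_set_exp lookup_single when_def A_def L_def)
      moreover have "Poly_Mapping.single k 1 + (L - set_exp A) \<in> upset w"
        using i j k neq by (auto simp: upset_def lookup_add lookup_minus lookup_set_exp lookup_single when_def A_def L_def)
      ultimately show ?thesis using that by (auto simp: A_def)
    qed
    \<comment> \<open>On \<open>i\<close>, \<open>j\<close>, \<open>k\<close> the forms
      \<open>c\<close>, \<open>d\<close>, \<open>1 - c - d\<close> are the dual basis, so their
      product on \<open>A\<close> is a sign.\<close>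
    have val: "c i = 1" "c j = 0" "c k = 0" "d i = 0" "d j = 1" "d k = 0"
      using i j k by (auto simp: c_def d_def L_def)
    have "wedge (\<lambda>_. 1) (wedge c (wedge d unit_form)) A
        = ksign k A * (1 - c k - d k) * wedge c (wedge d unit_form) (A - {k})"
      unfolding wedge_one_wedge_wedge by (rule wedge_single_term) (use neq val in \<open>auto simp: A_def\<close>)
    also have "A - {k} = {i, j}" using neq by (auto simp: A_def)
    also have "wedge c (wedge d unit_form) {i, j} = ksign i {i, j} * c i * wedge d unit_form ({i, j} - {i})"
      by (rule wedge_single_term) (use neq val in auto)
    also have "{i, j} - {i} = {j}" using neq by auto
    finally show "wedge (\<lambda>_. 1) (wedge c (wedge d unit_form)) A \<noteq> 0"
      using val by (simp add: wedge_unit_form_singleton ksign_nonzero)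
    fix T t assume t: "t \<in> \<Union> (upset ` {u, v, w})" "set_exp T + t = L"
    obtain x where x: "x \<in> {u, v, w}" "t \<in> upset x" using t(1) by blast
    have less: "Poly_Mapping.lookup x a < Poly_Mapping.lookup L a" if "a \<in> T" for a
    proof -
      have "Poly_Mapping.lookup x a \<le> Poly_Mapping.lookup t a" using x(2) by (simp add: upset_def)
      also have "\<dots> < Poly_Mapping.lookup L a"
        using that by (simp add: t(2)[symmetric] lookup_add lookup_set_exp)
      finally show ?thesis .
    qed
    consider "x = u" | "x = v" | "x = w" using x(1) by blast
    then show "wedge (\<lambda>_. 1) (wedge c (wedge d unit_form)) T = 0"
    proof cases
      case 1
      then have "c a = 0" if "a \<in> T" for a using less[OF that] by (simp add: c_def)
      then have "wedge c (wedge d unit_form) U = 0" if "U \<subseteq> T" for U :: "'n set"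
        using that by (intro wedge_zero_left) auto
      then show ?thesis by (rule wedge_zero_right)
    next
      case 2
      then have "d a = 0" if "a \<in> T" for a using less[OF that] by (simp add: d_def)
      then have d0: "wedge d unit_form U = 0" if "U \<subseteq> T" for U :: "'n set"
        using that by (intro wedge_zero_left) auto
      have "wedge c (wedge d unit_form) U = 0" if U: "U \<subseteq> T" for U :: "'n set"
        by (rule wedge_zero_right, rule d0) (use U in blast)
      then show ?thesis by (rule wedge_zero_right)
    next
      case 3
      have "1 - c a - d a = 0" if "a \<in> T" for a
        using less[OF that] 3 by (auto simp: c_def d_def L_def max_def split: if_splits)
      then show ?thesis unfolding wedge_one_wedge_wedge by (rule wedge_zero_left)
    qed
  qed
qed

section \<open>Upper bounds for the depth\<close>

context monomial_subquotient
begin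

lemma depth_le_two:
  assumes F: "F = {}" and card: "2 \<le> card (min_exps E)"
  shows "depth mpoly_ring irrelevant_ideal M \<le> enat (CARD('n) - 1)"
proof -
  obtain L A and c :: "'n \<Rightarrow> 'k" where A: "card A = 2" "A \<subseteq> Poly_Mapping.keys L"
    and cycle: "\<And>i. i \<in> A \<Longrightarrow> Poly_Mapping.single i 1 + (L - set_exp A) \<in> E"
    and q: "wedge (\<lambda>_. 1) (wedge c unit_form) A \<noteq> 0"
    "\<And>T t. t \<in> E \<Longrightarrow> set_exp T + t = L \<Longrightarrow> wedge (\<lambda>_. 1) (wedge c unit_form) T = 0"
    by (rule two_generators_class[OF upclosed_E card]) (rule that)
  from depth_le[OF koszul_class_contract_basis[OF A(2) F cycle q]] show ?thesis
    using A(1) by simp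
qed

text \<open>The chain \<open>u / x_i\<close> on the basis vector of \<open>i\<close> is a cycle
  modulo \<open>F\<close>. The cochain is 1 on singletons and 0 on the empty set, which by
  minimality of \<open>u\<close> is the only \<open>T\<close> with \<open>u / x_T\<close> in
  \<open>F\<close>.\<close>

lemma depth_quotient_le_one:
  assumes E: "E = UNIV" and u: "u \<in> min_exps F" "u \<noteq> 0"
  shows "depth mpoly_ring irrelevant_ideal M \<le> enat (CARD('n) - 1)"
proof -
  obtain i where i: "i \<in> Poly_Mapping.keys u" using u(2) by fastforce
  define q :: "'n set \<Rightarrow> 'k" where "q = wedge (\<lambda>_. 1) unit_form"
  have "koszul_class (supported F) (card {i}) (koszul_basis u {i})"
  proof (rule koszul_class_basis[where q = q])
    have "Poly_Mapping.single i 1 + (u - set_exp {i}) = u"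
      using i by (intro poly_mapping_eqI) (auto simp: set_exp_def lookup_add lookup_minus lookup_single when_def in_keys_iff)
    then show "Poly_Mapping.single j 1 + (u - set_exp {i}) \<in> F" if "j \<in> {i}" for j
      using that u(1) by (simp add: min_exps_def)
    show "q {i} \<noteq> 0" by (simp add: q_def wedge_unit_form_singleton)
    show "wedge (\<lambda>_. 1) q T = 0" for T by (simp add: q_def wedge_self)
    show "q T = 0" if t: "t \<in> F" "set_exp T + t = u" for T t
    proof -
      have "t = u" using t u(1) by (auto simp: min_exps_def upset_iff_diff add.commute)
      then have "set_exp T = 0" using t(2) by simp
      then have "i \<notin> T" for i using lookup_set_exp[of T i] by (auto split: if_splits)
      then have "T = {}" by blast
      then show ?thesis by (simp add: q_def wedge_def)
    qed
  qed (use i E in auto)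
  from depth_le[OF this] show ?thesis by simp
qed

lemma depth_quotient_le_two:
  assumes E: "E = UNIV" and card: "2 \<le> card (min_exps F)"
  shows "depth mpoly_ring irrelevant_ideal M \<le> enat (CARD('n) - 2)"
proof -
  obtain L A and c :: "'n \<Rightarrow> 'k" where A: "card A = 2" "A \<subseteq> Poly_Mapping.keys L"
    and cycle: "\<And>i. i \<in> A \<Longrightarrow> Poly_Mapping.single i 1 + (L - set_exp A) \<in> F"
    and q: "wedge (\<lambda>_. 1) (wedge c unit_form) A \<noteq> 0"
    "\<And>T t. t \<in> F \<Longrightarrow> set_exp T + t = L \<Longrightarrow> wedge (\<lambda>_. 1) (wedge c unit_form) T = 0"
    by (rule two_generators_class[OF upclosed_F card]) (rule that)
  have "koszul_class (supported F) (card A) (koszul_basis L A)"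
    by (rule koszul_class_basis[OF A(2) _ cycle wedge_self q]) (simp add: E)
  from depth_le[OF this] show ?thesis using A(1) by simp
qed

lemma depth_quotient_le_three:
  assumes E: "E = UNIV" and F: "F = \<Union> (upset ` {u, v, w})"
    and indep: "\<exists>i. max (Poly_Mapping.lookup v i) (Poly_Mapping.lookup w i) < Poly_Mapping.lookup u i"
      "\<exists>i. max (Poly_Mapping.lookup u i) (Poly_Mapping.lookup w i) < Poly_Mapping.lookup v i"
      "\<exists>i. max (Poly_Mapping.lookup u i) (Poly_Mapping.lookup v i) < Poly_Mapping.lookup w i"
  shows "depth mpoly_ring irrelevant_ideal M \<le> enat (CARD('n) - 3)"
proof -
  obtain L A and c d :: "'n \<Rightarrow> 'k" where A: "card A = 3" "A \<subseteq> Poly_Mapping.keys L"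
    and cycle: "\<And>i. i \<in> A \<Longrightarrow> Poly_Mapping.single i 1 + (L - set_exp A) \<in> F"
    and q: "wedge (\<lambda>_. 1) (wedge c (wedge d unit_form)) A \<noteq> 0"
    "\<And>T t. t \<in> F \<Longrightarrow> set_exp T + t = L \<Longrightarrow> wedge (\<lambda>_. 1) (wedge c (wedge d unit_form)) T = 0"
    by (rule three_generators_class[OF indep, folded F]) (rule that)
  have "koszul_class (supported F) (card A) (koszul_basis L A)"
    by (rule koszul_class_basis[OF A(2) _ cycle wedge_self q]) (simp add: E)
  from depth_le[OF this] show ?thesis using A(1) by simp
qed

end

section \<open>Stanley's conjecture\<close>

lemma ideal_sdepth_ge_depth:
  fixes E :: "('n::finite \<Rightarrow>\<^sub>0 nat) set"
  assumes E: "upclosed E" "E \<noteq> {}" and card: "card (min_exps E) \<le> 3"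
  defines "I \<equiv> supported E :: ('n, 'k::field) mpoly set"
  shows "depth mpoly_ring irrelevant_ideal (ideal_module mpoly_ring I)
    \<le> enat (sdepth (ideal_module mpoly_ring I) (ideal_grading I))"
proof -
  interpret monomial_subquotient E "{}" "ideal_module mpoly_ring I" "\<lambda>f. f"
    unfolding I_def by (rule ideal_module_subquotient[OF E(1)])
  have sdepth: "k \<le> sdepth (ideal_module mpoly_ring I) (ideal_grading I)" if "coned_dim k E" for k
  proof (rule sdepth_ge)
    show "coned_dim k (E - {})" "E - {} \<noteq> {}" using that E(2) by simp_all
    show "\<exists>a. t \<in> E \<longrightarrow> Poly_Mapping.single t 1 \<in> ideal_grading I a" for t
      unfolding I_def by (rule ideal_grading_xpow)
  qed
  have E_eq: "E = \<Union> (upset ` min_exps E)" by (rule upclosed_eq_upsets[OF E(1)])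
  have "min_exps E \<noteq> {}" using E_eq E(2) by auto
  then have "card (min_exps E) \<noteq> 0" using finite_min_exps[of E] by simp
  with card consider "card (min_exps E) = 1" | "card (min_exps E) = 2" | "card (min_exps E) = 3" by linarith
  then have "\<exists>k. coned_dim k E \<and> depth mpoly_ring irrelevant_ideal (ideal_module mpoly_ring I) \<le> enat k"
  proof cases
    case 1
    then obtain u where u: "min_exps E = {u}" by (rule card_1_singletonE)
    have "E = upset u" using E_eq u by simp
    then have "coned_dim (CARD('n)) E" using coned_dim_upset[of u] by simp
    moreover have "depth mpoly_ring irrelevant_ideal (ideal_module mpoly_ring I) \<le> enat (CARD('n))"
      by (rule depth_le_card[of u]) (use u in auto)
    ultimately show ?thesis by blast
  next
    case 2
    then obtain u v where uv: "min_exps E = {u, v}" by (auto simp: card_2_iff)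
    have "E = upset u \<union> upset v" using E_eq uv by simp
    then have "coned_dim (CARD('n) - 1) E" using coned_dim_upset_2[of u v] by simp
    moreover have "2 \<le> card (min_exps E)" using 2 by simp
    then have "depth mpoly_ring irrelevant_ideal (ideal_module mpoly_ring I) \<le> enat (CARD('n) - 1)"
      by (rule depth_le_two[OF refl])
    ultimately show ?thesis by blast
  next
    case 3
    then obtain u v w where uvw: "min_exps E = {u, v, w}" by (auto simp: card_3_iff)
    have "E = upset u \<union> upset v \<union> upset w" using E_eq uvw by auto
    then have "coned_dim (CARD('n) - 1) E" using coned_dim_upset_3[of u v w] by simp
    moreover have "2 \<le> card (min_exps E)" using 3 by simp
    then have "depth mpoly_ring irrelevant_ideal (ideal_module mpoly_ring I) \<le> enat (CARD('n) - 1)"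
      by (rule depth_le_two[OF refl])
    ultimately show ?thesis by blast
  qed
  then obtain k where k: "coned_dim k E" "depth mpoly_ring irrelevant_ideal (ideal_module mpoly_ring I) \<le> enat k"
    by blast
  note k(2)
  also have "enat k \<le> enat (sdepth (ideal_module mpoly_ring I) (ideal_grading I))" using sdepth[OF k(1)] by simp
  finally show ?thesis .
qed

lemma quotient_sdepth_ge_depth:
  fixes F :: "('n::finite \<Rightarrow>\<^sub>0 nat) set"
  assumes F: "upclosed F" "F \<noteq> UNIV" and card: "card (min_exps F) \<le> 3"
  defines "I \<equiv> supported F :: ('n, 'k::field) mpoly set"
  shows "depth mpoly_ring irrelevant_ideal (quotient_module mpoly_ring I)
    \<le> enat (sdepth (quotient_module mpoly_ring I) (quotient_grading I))"
proof -
  interpret monomial_subquotient UNIV F "quotient_module mpoly_ring I" "\<lambda>f. I +>\<^bsub>mpoly_ring\<^esub> f"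
    unfolding I_def by (rule quotient_module_subquotient[OF F(1)])
  let ?depth = "depth mpoly_ring irrelevant_ideal (quotient_module mpoly_ring I)"
  have sdepth: "k \<le> sdepth (quotient_module mpoly_ring I) (quotient_grading I)" if "coned_dim k (UNIV - F)" for k
    by (rule sdepth_ge[OF that]) (use F(2) quotient_grading_xpow in blast)+
  have F_eq: "F = \<Union> (upset ` min_exps F)" by (rule upclosed_eq_upsets[OF F(1)])
  have zero: "0 \<notin> F"
  proof
    assume "0 \<in> F"
    then have "0 + t \<in> F" for t using F(1) unfolding upclosed_def by blast
    then show False using F(2) by auto
  qed
  have coned: "coned_dim (CARD('n) - card (min_exps F)) (UNIV - F)"
    using coned_dim_Diff_upset_finite[OF finite_min_exps coned_dim_UNIV, of F] F_eq by simp
  have depth2: "?depth \<le> enat (CARD('n) - 2)" if "2 \<le> card (min_exps F)"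
    using refl that by (rule depth_quotient_le_two)
  consider "card (min_exps F) = 0" | "card (min_exps F) = 1" | "card (min_exps F) = 2" | "card (min_exps F) = 3"
    using card by linarith
  then have "\<exists>k. coned_dim k (UNIV - F) \<and> ?depth \<le> enat k"
  proof cases
    case 1
    \<comment> \<open>Here \<open>I = 0\<close>, and the exponent 0 is the minimal generator of
      \<open>S\<close>.\<close>
    have "?depth \<le> enat (CARD('n))"
      by (rule depth_le_card[of 0]) (use zero in \<open>auto simp: min_exps_def upset_def intro!: poly_mapping_eqI\<close>)
    with coned 1 show ?thesis by auto
  next
    case 2
    then have "min_exps F \<noteq> {}" by auto
    then obtain u where u: "u \<in> min_exps F" by blast
    then have "?depth \<le> enat (CARD('n) - 1)" by (rule depth_quotient_le_one[OF refl]) (use zero u in \<open>auto simp: min_exps_def\<close>)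
    with coned 2 show ?thesis by auto
  next
    case 3
    with coned depth2 show ?thesis by auto
  next
    case 4
    then obtain u v w where uvw: "min_exps F = {u, v, w}" by (auto simp: card_3_iff)
    define below_lcm where "below_lcm x y z \<longleftrightarrow>
      (\<forall>i. Poly_Mapping.lookup x i \<le> max (Poly_Mapping.lookup y i) (Poly_Mapping.lookup z i))"
      for x y z :: "'n \<Rightarrow>\<^sub>0 nat"
    have F_uvw: "F = \<Union> (upset ` {u, v, w})" using F_eq uvw by simp
    show ?thesis
    \<comment> \<open>If one generator divides the least common multiple of the others, the depth
      bound is only \<open>n - 2\<close>, and removing that generator before the others saves the
      missing dimension. Otherwise the class in degree 3 lowers the depth bound to the
      \<open>n - 3\<close> of the generic partition.\<close>
    proof (cases "below_lcm u v w \<or> below_lcm v u w \<or> below_lcm w u v")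
      case True
      then obtain x y z where xyz: "{u, v, w} = {y, z, x}" "below_lcm x y z"
        by (elim disjE) (blast | metis insert_commute)+
      have "coned_dim (CARD('n) - 2) (UNIV - F)"
        unfolding F_uvw xyz(1) by (rule coned_dim_compl_three) (use xyz(2) in \<open>simp add: below_lcm_def\<close>)
      with depth2 4 show ?thesis by auto
    next
      case False
      have "?depth \<le> enat (CARD('n) - 3)"
      proof (rule depth_quotient_le_three[OF refl F_uvw])
        show "\<exists>i. max (Poly_Mapping.lookup v i) (Poly_Mapping.lookup w i) < Poly_Mapping.lookup u i"
          "\<exists>i. max (Poly_Mapping.lookup u i) (Poly_Mapping.lookup w i) < Poly_Mapping.lookup v i"
          "\<exists>i. max (Poly_Mapping.lookup u i) (Poly_Mapping.lookup v i) < Poly_Mapping.lookup w i"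
          using False by (simp_all only: below_lcm_def not_le de_Morgan_disj not_all)
      qed
      with coned 4 show ?thesis by auto
    qed
  qed
  then obtain k where k: "coned_dim k (UNIV - F)" "?depth \<le> enat k" by blast
  note k(2)
  also have "enat k \<le> enat (sdepth (quotient_module mpoly_ring I) (quotient_grading I))" using sdepth[OF k(1)] by simp
  finally show ?thesis .
qed

theorem theorem2p6:
  fixes I :: "('n::finite, 'k::field) mpoly set"
  assumes "monomial_ideal I" and "card (min_gens I) \<le> 3"
  shows "(I \<noteq> {\<zero>\<^bsub>mpoly_ring\<^esub>} \<longrightarrow>
      enat (sdepth (ideal_module mpoly_ring I) (ideal_grading I))
        \<ge> depth mpoly_ring irrelevant_ideal (ideal_module mpoly_ring I)) \<and>
    (I \<noteq> carrier mpoly_ring \<longrightarrow>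
      enat (sdepth (quotient_module mpoly_ring I) (quotient_grading I))
        \<ge> depth mpoly_ring irrelevant_ideal (quotient_module mpoly_ring I))"
proof -
  obtain E where E: "upclosed E" and I: "I = supported E"
    using monomial_ideal_supported[OF assms(1)] .
  have card: "card (min_exps E) \<le> 3"
    using assms(2) unfolding I card_min_gens_supported .
  have "E \<noteq> {}" if "I \<noteq> {\<zero>\<^bsub>mpoly_ring\<^esub>}"
    using that by (auto simp: I supported_empty)
  moreover have "E \<noteq> UNIV" if "I \<noteq> carrier mpoly_ring"
    using that by (auto simp: I supported_UNIV)
  ultimately show ?thesis
    using ideal_sdepth_ge_depth[OF E _ card, where 'k='k] quotient_sdepth_ge_depth[OF E _ card, where 'k='k]
    unfolding I by blast
qed

end
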